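(* Let $(X,\|\cdot\|_X)$ be a real Banach space, let $\varphi$ be a gauge, and let $T:X\to2^{X^*}$ be maximally monotone with $T(0)\neq\varnothing$. Then: (i) if $(X,\|\cdot\|_X)$ is Fr\'echet differentiable and uniformly convex, then $\overleftarrow{\mathrm{res}}^{\Psi_\varphi}_T=(T+j_\varphi)^{-1}\circ j_\varphi$ maps $X$ onto $\mathrm{dom}(T)$ and is norm-to-norm continuous on $X$; (ii) if $(X,\|\cdot\|_X)$ is strictly convex, uniformly Fr\'echet differentiable, and has the Radon--Riesz--Shmul'yan property, then $\overrightarrow{\mathrm{res}}^{\Psi_\varphi}_T=j_\varphi\circ(T+j_\varphi)^{-1}$ maps $X^*$ onto $j_\varphi(\mathrm{dom}(T))$ and is norm-to-norm continuous on $X^*$.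
   Context: A gauge is a strictly increasing continuous $\varphi:[0,\infty[\to[0,\infty[$ with $\varphi(0)=0$, $\lim_{t\to\infty}\varphi(t)=\infty$; $\Psi_\varphi(x)=\int_0^{\|x\|}\varphi(t)\,dt$. The duality map is $j_\varphi(x)=\{y\in X^*:\langle x,y\rangle=\|x\|\|y\|,\ \|y\|=\varphi(\|x\|)\}$, single-valued when the norm is Gateaux differentiable off $0$, and then $j_\varphi=D\Psi_\varphi$ (Gateaux derivative). $(X,\|\cdot\|)$ is Fr\'echet (resp. uniformly Fr\'echet) differentiable iff its norm is Fr\'echet differentiable at each $x\ne0$ (resp. the limit defining the derivative of the norm at $x$ in direction $h$ is uniform in $x,h$ in the unit sphere). Radon--Riesz--Shmul'yan property: if $x_n\to x$ weakly and $\|x_n\|\to\|x\|$, then $\|x_n-x\|\to0$. For $T:X\to2^{X^*}$, $\mathrm{dom}(T)=\{x:T(x)\neq\varnothing\}$; $T$ is monotone iff $\langle x-y,v-w\rangle\ge0$ for all $v\in T(x)$, $w\in T(y)$; maximally monotone iff monotone and its graph is not properly contained in the graph of another monotone map. The left and right resolvents are $\overleftarrow{\mathrm{res}}^{\Psi}_{T}=(D\Psi+T)^{-1}\circ D\Psi:X\to2^X$ and $\overrightarrow{\mathrm{res}}^{\Psi}_{T}=(\mathrm{id}_{X^*}+T\circ D\Psi^* )^{-1}:X^*\to2^{X^*}$, where $\Psi^*$ is the convex conjugate. *)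

theory Defs
  imports "HOL-Analysis.Analysis"
begin

text \<open>The dual of a real normed space \<open>'a\<close> is the type \<open>'a \<Rightarrow>\<^sub>L real\<close> with the operator norm.\<close>

type_synonym 'a dual = "'a \<Rightarrow>\<^sub>L real"

subsection \<open>Geometry of the norm\<close>

definition gateaux_derivs :: "('b::real_normed_vector \<Rightarrow> real) \<Rightarrow> 'b \<Rightarrow> 'b dual set"
  where "gateaux_derivs f x =
    {D. \<forall>h. ((\<lambda>t. (f (x + t *\<^sub>R h) - f x) / t) \<longlongrightarrow> blinfun_apply D h) (at 0)}"

lemma gateaux_derivs_unique:
  assumes "D \<in> gateaux_derivs f x" "E \<in> gateaux_derivs f x"
  shows "D = E"
proof (rule blinfun_eqI)
  fix h
  from assms show "blinfun_apply D h = blinfun_apply E h"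
    unfolding gateaux_derivs_def by (auto intro: tendsto_unique[OF trivial_limit_at])
qed

definition frechet_smooth :: "'a::real_normed_vector itself \<Rightarrow> bool"
  where "frechet_smooth _ \<longleftrightarrow> (\<forall>x::'a. x \<noteq> 0 \<longrightarrow> (norm :: 'a \<Rightarrow> real) differentiable (at x))"

definition uniformly_frechet_smooth :: "'a::real_normed_vector itself \<Rightarrow> bool"
  where "uniformly_frechet_smooth _ \<longleftrightarrow>
    (\<exists>D :: 'a \<Rightarrow> 'a dual.
      uniform_limit (sphere 0 1 \<times> sphere 0 1)
        (\<lambda>t (x, h). (norm (x + t *\<^sub>R h) - norm x) / t)
        (\<lambda>(x, h). blinfun_apply (D x) h) (at 0))"

definition uniformly_convex :: "'a::real_normed_vector itself \<Rightarrow> bool"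
  where "uniformly_convex _ \<longleftrightarrow>
    (\<forall>\<epsilon>>0. \<exists>\<delta>>0. \<forall>x y :: 'a. norm x = 1 \<longrightarrow> norm y = 1 \<longrightarrow> norm (x - y) \<ge> \<epsilon> \<longrightarrow>
      norm ((1/2) *\<^sub>R (x + y)) \<le> 1 - \<delta>)"

definition strictly_convex :: "'a::real_normed_vector itself \<Rightarrow> bool"
  where "strictly_convex _ \<longleftrightarrow>
    (\<forall>x y :: 'a. norm x = 1 \<longrightarrow> norm y = 1 \<longrightarrow> x \<noteq> y \<longrightarrow> norm ((1/2) *\<^sub>R (x + y)) < 1)"

definition weakly_tends :: "(nat \<Rightarrow> 'a::real_normed_vector) \<Rightarrow> 'a \<Rightarrow> bool"
  where "weakly_tends X x \<longleftrightarrow>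
    (\<forall>f :: 'a dual. (\<lambda>n. blinfun_apply f (X n)) \<longlonglongrightarrow> blinfun_apply f x)"

definition radon_riesz_shmulyan :: "'a::real_normed_vector itself \<Rightarrow> bool"
  where "radon_riesz_shmulyan _ \<longleftrightarrow>
    (\<forall>(X :: nat \<Rightarrow> 'a) x. weakly_tends X x \<longrightarrow> (\<lambda>n. norm (X n)) \<longlonglongrightarrow> norm x \<longrightarrow>
      (\<lambda>n. norm (X n - x)) \<longlonglongrightarrow> 0)"

subsection \<open>Gauges, potentials, duality maps\<close>

text \<open>A gauge is a function on \<open>{0..}\<close>; its values on negative reals are irrelevant.\<close>

definition gauge_fun :: "(real \<Rightarrow> real) \<Rightarrow> bool"
  where "gauge_fun \<phi> \<longleftrightarrow>
    strict_mono_on {0..} \<phi> \<and> continuous_on {0..} \<phi> \<and> \<phi> 0 = 0 \<and> filterlim \<phi> at_top at_top"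

definition potential :: "(real \<Rightarrow> real) \<Rightarrow> 'a::real_normed_vector \<Rightarrow> real"
  where "potential \<phi> x = integral {0..norm x} \<phi>"

definition duality_map :: "(real \<Rightarrow> real) \<Rightarrow> 'a::real_normed_vector \<Rightarrow> 'a dual set"
  where "duality_map \<phi> x =
    {y. blinfun_apply y x = norm x * norm y \<and> norm y = \<phi> (norm x)}"

text \<open>The conjugate is real-valued, so it is meaningful only where the supremum is finite.
  For \<open>\<Psi> = potential \<phi>\<close> this is everywhere, see \<open>bdd_above_conjugate_potential\<close>.\<close>

definition conjugate :: "('a::real_normed_vector \<Rightarrow> real) \<Rightarrow> 'a dual \<Rightarrow> real"
  where "conjugate \<Psi> y = (SUP x. blinfun_apply y x - \<Psi> x)"

lemma bdd_above_conjugate_potential: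
  fixes y :: "('a::real_normed_vector) dual"
  assumes g: "gauge_fun \<phi>"
  shows "bdd_above (range (\<lambda>x. blinfun_apply y x - potential \<phi> x))"
proof -
  have cont: "continuous_on {0..} \<phi>" and sm: "strict_mono_on {0..} \<phi>" and "\<phi> 0 = 0"
    using g by (auto simp: gauge_fun_def)
  have nonneg: "\<phi> t \<ge> 0" if "t \<ge> 0" for t
    using strict_mono_onD[OF sm, of 0 t] that \<open>\<phi> 0 = 0\<close> by (cases "t = 0") auto
  have int: "\<phi> integrable_on {a..b}" if "a \<ge> 0" for a b
    using that by (intro integrable_continuous_real continuous_on_subset[OF cont]) auto
  have "eventually (\<lambda>t. \<phi> t \<ge> norm y) at_top"
    using g by (auto simp: gauge_fun_def filterlim_at_top)
  then obtain R0 where R0: "\<And>t. t \<ge> R0 \<Longrightarrow> \<phi> t \<ge> norm y"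
    by (auto simp: eventually_at_top_linorder)
  define R where "R = max R0 0"
  have R: "\<And>t. t \<ge> R \<Longrightarrow> \<phi> t \<ge> norm y" and "R \<ge> 0"
    using R0 by (auto simp: R_def)
  have "blinfun_apply y x - potential \<phi> x \<le> norm y * R" for x
  proof -
    have le: "blinfun_apply y x \<le> norm y * norm x"
      using norm_blinfun[of y x] by (simp add: abs_le_iff)
    show ?thesis
    proof (cases "norm x \<le> R")
      case True
      have "potential \<phi> x \<ge> 0"
        unfolding potential_def by (rule integral_nonneg) (use nonneg int in auto)
      moreover have "norm y * norm x \<le> norm y * R"
        using True by (simp add: mult_left_mono)
      ultimately show ?thesis using le by linarith
    next
      case False
      have "integral {0..R} \<phi> + integral {R..norm x} \<phi> = potential \<phi> x"
        unfolding potential_def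
        by (rule Henstock_Kurzweil_Integration.integral_combine) (use False \<open>R \<ge> 0\<close> int in auto)
      moreover have "integral {0..R} \<phi> \<ge> 0"
        by (rule integral_nonneg) (use nonneg int in auto)
      moreover have "integral {R..norm x} (\<lambda>_. norm y) \<le> integral {R..norm x} \<phi>"
        by (rule integral_le) (use R int \<open>R \<ge> 0\<close> in auto)
      ultimately have "norm y * (norm x - R) \<le> potential \<phi> x"
        using False by (simp add: mult.commute)
      then show ?thesis using le by (simp add: algebra_simps)
    qed
  qed
  then show ?thesis by (auto simp: bdd_above_def)
qed

text \<open>The Gateaux derivative of a function on the dual lives in the bidual; it is regarded as a
  point of \<open>'a\<close> through the canonical embedding.\<close>

definition bidual_embed :: "'a::real_normed_vector \<Rightarrow> 'a dual dual"
  where "bidual_embed x = Blinfun (\<lambda>y. blinfun_apply y x)"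

lemma blinfun_apply_bidual_embed [simp]: "blinfun_apply (bidual_embed x) y = blinfun_apply y x"
  unfolding bidual_embed_def by (simp add: bounded_linear_Blinfun_apply blinfun.bounded_linear_left)

definition gateaux_derivs_predual :: "('a::real_normed_vector dual \<Rightarrow> real) \<Rightarrow> 'a dual \<Rightarrow> 'a set"
  where "gateaux_derivs_predual F y = {x. bidual_embed x \<in> gateaux_derivs F y}"

subsection \<open>Set-valued operators and resolvents\<close>

definition op_dom :: "('a \<Rightarrow> 'b set) \<Rightarrow> 'a set"
  where "op_dom T = {x. T x \<noteq> {}}"

definition op_inverse :: "('a \<Rightarrow> 'b set) \<Rightarrow> 'b \<Rightarrow> 'a set"
  where "op_inverse T y = {x. y \<in> T x}"

definition op_comp :: "('b \<Rightarrow> 'c set) \<Rightarrow> ('a \<Rightarrow> 'b set) \<Rightarrow> 'a \<Rightarrow> 'c set"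
  where "op_comp S T x = (\<Union>y\<in>T x. S y)"

text \<open>On sets, \<open>+\<close> is the Minkowski sum.\<close>

definition op_plus :: "('a \<Rightarrow> 'b::plus set) \<Rightarrow> ('a \<Rightarrow> 'b set) \<Rightarrow> 'a \<Rightarrow> 'b set"
  where "op_plus S T x = S x + T x"

definition monotone_operator :: "('a::real_normed_vector \<Rightarrow> 'a dual set) \<Rightarrow> bool"
  where "monotone_operator T \<longleftrightarrow>
    (\<forall>x y. \<forall>v\<in>T x. \<forall>w\<in>T y. blinfun_apply (v - w) (x - y) \<ge> 0)"

definition maximally_monotone :: "('a::real_normed_vector \<Rightarrow> 'a dual set) \<Rightarrow> bool"
  where "maximally_monotone T \<longleftrightarrow> monotone_operator T \<and>
    (\<forall>S. monotone_operator S \<longrightarrow> \<not> Sigma UNIV T \<subset> Sigma UNIV S)"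

definition left_resolvent ::
    "('a::real_normed_vector \<Rightarrow> real) \<Rightarrow> ('a \<Rightarrow> 'a dual set) \<Rightarrow> 'a \<Rightarrow> 'a set"
  where "left_resolvent \<Psi> T =
    op_comp (op_inverse (op_plus (gateaux_derivs \<Psi>) T)) (gateaux_derivs \<Psi>)"

definition right_resolvent ::
    "('a::real_normed_vector \<Rightarrow> real) \<Rightarrow> ('a \<Rightarrow> 'a dual set) \<Rightarrow> 'a dual \<Rightarrow> 'a dual set"
  where "right_resolvent \<Psi> T =
    op_inverse (op_plus (\<lambda>y. {y}) (op_comp T (gateaux_derivs_predual (conjugate \<Psi>))))"

end

(*
To solve y - j z in T z, let f be the function of (z, w) in X x X* given, with Psi the potential,
for (a, b) in the graph of T - y by
  f (z, w) = Psi z + Psi* w - w a + b z - b a.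
If all these functions are nonpositive at (z, w), then maximality puts y - w into T z, and the
Fenchel-Young inequality becomes an equality, so w = j z. Each f is convex, and by monotonicity
any convex combination of them is nonpositive at (z, j z) for z the barycentre of the points a.
A theorem of the alternative therefore solves finitely many of the inequalities approximately, and
weak compactness solves all of them. Reflexivity comes from the uniform convexity of X in (i),
and of X* in (ii). For the continuity, let z' solve y' - j z' in T z' and z solve
y - j z in T z. Monotonicity gives <z' - z, j z' - j z> <= <z' - z, y' - y>, so the left side
tends to 0 as y' tends to y; this forces |z'| --> |z|, <z', j z> --> <z, j z> and
<z, j z'> --> <z, j z>, which is norm convergence of z' in a uniformly convex X, and of j z' in a
uniformly convex X*.
*)

theory Submission
  imports Defs
begin

section \<open>A theorem of the alternative for convex functions\<close>

text \<open>The duality map is not linear, so \<open>y - j z\<close> in \<open>T z\<close> is not a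
  convex condition on z. Making w an independent variable and charging \<open>\<Psi>c w\<close> for
  it restores convexity, because the only bilinear term, the pairing of z with w, cancels. The
  alternative uses no topology on the underlying vector space; the price is a slack \<epsilon>, as
  it speaks of strict negativity, which monotonicity does not give. A point of \<open>T 0\<close>
  supplies coercivity: at a = 0 the pairing of w with a vanishes, and bounds on z and w follow. The
  same point bounds the resolvents locally. Functionals are not obtained by extension theorems. The
  same alternative yields Helly's theorem on finitely many linear equations in a ball, uniform
  convexity and completeness make approximate solutions exact, and this serves both proofs of
  reflexivity; norming functionals are values of j. The right resolvent is defined through the
  derivative of the conjugate, so (ii) also requires that this derivative is the inverse of j. Weak
  continuity of the inverse is enough for that.\<close>

lemma convex_on_sublevel:
  assumes "convex_on C f"
  shows "convex {x\<in>C. f x < (c::real)}"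
proof (rule convexI)
  fix x y u v
  assume x: "x \<in> {x\<in>C. f x < c}" and y: "y \<in> {x\<in>C. f x < c}"
    and uv: "0 \<le> (u::real)" "0 \<le> v" "u + v = 1"
  have "u *\<^sub>R x + v *\<^sub>R y \<in> C"
    using assms x y uv by (auto simp: convex_on_def intro: convexD)
  moreover have "f (u *\<^sub>R x + v *\<^sub>R y) \<le> u * f x + v * f y"
    using assms x y uv by (auto simp: convex_on_def)
  moreover have "u * f x + v * f y < c"
    by (rule convex_bound_lt) (use x y uv in auto)
  ultimately show "u *\<^sub>R x + v *\<^sub>R y \<in> {x\<in>C. f x < c}" by auto
qed

text \<open>Up to normalisation the claim is \<open>f x + t * g x \<ge> 0\<close> for one
  \<open>t \<ge> 0\<close>. A point with \<open>g < 0\<close> bounds t above by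
  \<open>f / - g\<close>, a point with \<open>f < 0\<close> bounds it below by
  \<open>- f / g\<close>. Convexity on the segment between two such points puts each lower bound
  below each upper bound, so the infimum of the upper bounds serves.\<close>

lemma convex_alternative_two:
  fixes f g :: "'v::real_vector \<Rightarrow> real"
  assumes f: "convex_on C f" and g: "convex_on C g"
    and alt: "\<And>x. x \<in> C \<Longrightarrow> f x \<ge> 0 \<or> g x \<ge> 0"
  shows "\<exists>l\<in>{0..1}. \<forall>x\<in>C. l * f x + (1 - l) * g x \<ge> 0"
proof (cases "\<forall>y\<in>C. g y \<ge> 0")
  case True
  then show ?thesis by (intro bexI[of _ 0]) auto
next
  case False
  then obtain y0 where y0: "y0 \<in> C" "g y0 < 0" by force
  have cross: "f x * g y \<le> f y * g x" if x: "x \<in> C" "f x < 0" and y: "y \<in> C" "g y < 0" for x y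
  proof (rule ccontr)
    assume "\<not> ?thesis"
    then have less: "f x * g y > f y * g x" by simp
    have gx: "g x \<ge> 0" and fy: "f y \<ge> 0" using alt[of x] alt[of y] x y by auto
    \<comment> \<open>At weight s on x, the interpolated value of g is negative exactly for
      \<open>s < s1\<close> and that of f exactly for \<open>s > s2\<close>. If the cross inequality
      failed, some s would lie strictly between, and both functions would be negative at one
      point.\<close>
    define s1 where "s1 = - g y / (g x - g y)"
    define s2 where "s2 = f y / (f y - f x)"
    have "s2 < s1" unfolding s1_def s2_def
      using less x y gx fy by (simp add: divide_simps) (simp add: algebra_simps)
    then obtain s where s: "s2 < s" "s < s1" using dense by blast
    have "0 \<le> s2" "s1 \<le> 1" unfolding s1_def s2_def using x y gx fy by (auto simp: divide_simps)
    then have s01: "0 \<le> s" "0 \<le> 1 - s" "s + (1 - s) = 1" using s by auto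
    have "s * f x + (1 - s) * f y < 0"
      using s(1) x fy unfolding s2_def by (simp add: divide_simps) (simp add: algebra_simps)
    moreover have "s * g x + (1 - s) * g y < 0"
      using s(2) y gx unfolding s1_def by (simp add: divide_simps) (simp add: algebra_simps)
    moreover have "f (s *\<^sub>R x + (1 - s) *\<^sub>R y) \<le> s * f x + (1 - s) * f y"
      "g (s *\<^sub>R x + (1 - s) *\<^sub>R y) \<le> s * g x + (1 - s) * g y"
      using f g x y s01 unfolding convex_on_def by blast+
    moreover have "s *\<^sub>R x + (1 - s) *\<^sub>R y \<in> C"
      using f x y s01 unfolding convex_on_def by (auto intro: convexD)
    ultimately show False using alt[of "s *\<^sub>R x + (1 - s) *\<^sub>R y"] by linarith
  qed
  define A where "A = {f y / - g y | y. y \<in> C \<and> g y < 0}"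
  have A_ge: "a \<ge> 0" if "a \<in> A" for a
    using that alt unfolding A_def by (force simp: divide_simps)
  have "A \<noteq> {}" and "bdd_below A"
    using y0 A_ge by (auto simp: A_def bdd_below_def)
  define t where "t = Inf A"
  have t0: "t \<ge> 0" unfolding t_def by (rule cInf_greatest) (use A_ge \<open>A \<noteq> {}\<close> in auto)
  have main: "f x + t * g x \<ge> 0" if x: "x \<in> C" for x
  proof -
    consider "g x < 0" | "f x < 0" "g x \<ge> 0" | "f x \<ge> 0" "g x \<ge> 0" by linarith
    then show ?thesis
    proof cases
      case 1
      then have "t \<le> f x / - g x"
        unfolding t_def using x by (intro cInf_lower \<open>bdd_below A\<close>) (auto simp: A_def)
      then show ?thesis using 1 by (simp add: divide_simps)
    next
      case 2
      have "f x * g y0 > 0" using 2 y0 by (simp add: mult_neg_neg)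
      then have "g x \<noteq> 0" using cross[OF x 2(1) y0] by auto
      then have gx: "g x > 0" using 2 by simp
      have "- f x / g x \<le> a" if a: "a \<in> A" for a
      proof -
        obtain y where y: "y \<in> C" "g y < 0" "a = f y / - g y" using a unfolding A_def by blast
        then show ?thesis
          using cross[OF x 2(1) y(1,2)] gx
          unfolding y(3) pos_divide_le_eq[OF gx] times_divide_eq_left
          by (subst pos_le_divide_eq) auto
      qed
      then have "- f x / g x \<le> t"
        unfolding t_def using \<open>A \<noteq> {}\<close> by (intro cInf_greatest) auto
      then show ?thesis using gx by (simp add: divide_simps)
    next
      case 3
      then show ?thesis using t0 by simp
    qed
  qed
  have "1 - 1 / (1 + t) = t / (1 + t)" using t0 by (simp add: divide_simps)
  then have "(1 / (1 + t)) * f x + (1 - 1 / (1 + t)) * g x = (f x + t * g x) / (1 + t)" for x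
    by (simp add: add_divide_distrib)
  then show ?thesis
    using main t0 by (intro bexI[of _ "1 / (1 + t)"]) auto
qed

lemma convex_on_sum_fun:
  fixes f :: "'i \<Rightarrow> 'v::real_vector \<Rightarrow> real"
  assumes "convex C" "\<And>i. i \<in> I \<Longrightarrow> convex_on C (f i)"
  shows "convex_on C (\<lambda>x. \<Sum>i\<in>I. f i x)"
  using assms
proof (induction I rule: infinite_finite_induct)
  case (insert j I)
  then have "convex_on C (\<lambda>x. f j x + (\<Sum>i\<in>I. f i x))" by (intro convex_on_add) auto
  then show ?case using insert by simp
qed (auto simp: convex_on_const)

text \<open>Where \<open>f j < 0\<close>, the alternative holds for the remaining functions, and the
  induction hypothesis on this smaller convex set gives a combination h that is nonnegative there.
  Then h and \<open>f j\<close> satisfy the alternative for two functions on all of C. The set must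
  therefore vary in the induction.\<close>

lemma convex_alternative:
  fixes f :: "'i \<Rightarrow> 'v::real_vector \<Rightarrow> real"
  assumes "finite I" "I \<noteq> {}" "convex C" "\<And>i. i \<in> I \<Longrightarrow> convex_on C (f i)"
    and "\<And>x. x \<in> C \<Longrightarrow> \<exists>i\<in>I. f i x \<ge> 0"
  shows "\<exists>l. (\<forall>i\<in>I. l i \<ge> 0) \<and> sum l I = (1::real) \<and> (\<forall>x\<in>C. (\<Sum>i\<in>I. l i * f i x) \<ge> 0)"
  using assms
proof (induction I arbitrary: C rule: finite_ne_induct)
  case (singleton i)
  then show ?case by (intro exI[of _ "\<lambda>_. 1"]) auto
next
  case (insert j I)
  define C' where "C' = {x\<in>C. f j x < 0}"
  have fj: "convex_on C (f j)" using insert.prems by auto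
  have sub: "C' \<subseteq> C" by (auto simp: C'_def)
  have C': "convex C'" unfolding C'_def by (rule convex_on_sublevel[OF fj])
  have "\<exists>l. (\<forall>i\<in>I. l i \<ge> 0) \<and> sum l I = 1 \<and> (\<forall>x\<in>C'. (\<Sum>i\<in>I. l i * f i x) \<ge> 0)"
  proof (rule insert.IH)
    show "convex_on C' (f i)" if "i \<in> I" for i
      using insert.prems(2)[of i] that sub C' convex_on_subset by blast
    show "\<exists>i\<in>I. f i x \<ge> 0" if "x \<in> C'" for x
      using insert.prems(3)[of x] that by (auto simp: C'_def)
  qed (use C' in auto)
  then obtain l where l: "\<forall>i\<in>I. l i \<ge> 0" "sum l I = 1"
    "\<And>x. x \<in> C' \<Longrightarrow> (\<Sum>i\<in>I. l i * f i x) \<ge> 0" by blast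
  define h where "h x = (\<Sum>i\<in>I. l i * f i x)" for x
  have h: "convex_on C h"
    unfolding h_def
    using insert.hyps l insert.prems by (intro convex_on_sum_fun convex_on_cmul) auto
  obtain m where m: "m \<in> {0..1}" "\<And>x. x \<in> C \<Longrightarrow> m * h x + (1 - m) * f j x \<ge> 0"
    using convex_alternative_two[OF h fj] l(3) unfolding C'_def h_def by fastforce
  define l' where "l' = (\<lambda>i. if i = j then 1 - m else m * l i)"
  have "sum l' I = m * sum l I"
    unfolding l'_def sum_distrib_left using insert.hyps by (intro sum.cong) auto
  then have "sum l' (insert j I) = 1"
    using insert.hyps l by (simp add: l'_def)
  moreover have "(\<Sum>i\<in>insert j I. l' i * f i x) = m * h x + (1 - m) * f j x" for x
  proof -
    have "(\<Sum>i\<in>I. l' i * f i x) = m * h x"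
      unfolding l'_def h_def sum_distrib_left using insert.hyps by (intro sum.cong) auto
    then show ?thesis using insert.hyps by (simp add: l'_def)
  qed
  moreover have "\<forall>i\<in>insert j I. l' i \<ge> 0"
    using l m by (auto simp: l'_def)
  ultimately show ?case using m by (intro exI[of _ l']) auto
qed

section \<open>Uniform convexity and reflexivity\<close>

lemma dual_norm_le:
  fixes v :: "'a::real_normed_vector dual"
  assumes "\<And>x. norm x \<le> 1 \<Longrightarrow> blinfun_apply v x \<le> b"
  shows "norm v \<le> b"
proof (rule norm_blinfun_bound)
  show "0 \<le> b" using assms[of 0] by simp
  fix x :: 'a
  show "norm (blinfun_apply v x) \<le> b * norm x"
  proof (cases "x = 0")
    case False
    have "blinfun_apply v (x /\<^sub>R norm x) \<le> b" "blinfun_apply v (- (x /\<^sub>R norm x)) \<le> b"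
      using False by (intro assms; simp)+
    then have "blinfun_apply v x \<le> b * norm x" "- blinfun_apply v x \<le> b * norm x"
      using False by (simp_all add: blinfun.scaleR_right blinfun.minus_right field_simps)
    then show ?thesis by simp
  qed simp
qed

lemma blinfun_apply_le:
  fixes v :: "'a::real_normed_vector dual"
  shows "blinfun_apply v x \<le> norm v * norm x"
  using norm_blinfun[of v x] by simp

text \<open>If the sum is nearly of norm 2, both points are nearly of norm 1, and normalising them
  moves each by less than \<open>\<delta>\<close>. This extends the modulus from the sphere to the
  ball, where the approximate solutions below live.\<close>

lemma uniformly_convex_unit_ball:
  assumes uc: "uniformly_convex TYPE('b::real_normed_vector)" and "\<epsilon> > 0"
  obtains \<delta> where "\<delta> > 0"
    "\<And>x y :: 'b. norm x \<le> 1 \<Longrightarrow> norm y \<le> 1 \<Longrightarrow> norm (x + y) > 2 - \<delta> \<Longrightarrow> norm (x - y) < \<epsilon>"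
proof -
  obtain d where d: "d > 0" "\<And>x y :: 'b. norm x = 1 \<Longrightarrow> norm y = 1 \<Longrightarrow> norm (x - y) \<ge> \<epsilon> / 2 \<Longrightarrow>
      norm ((1/2) *\<^sub>R (x + y)) \<le> 1 - d"
    using uc half_gt_zero[OF \<open>\<epsilon> > 0\<close>] unfolding uniformly_convex_def by meson
  \<comment> \<open>The bound \<open>d / 2\<close> gives \<open>3 * \<delta> < 2 * d\<close>, which
    contradicts a sum of norm above \<open>2 - \<delta>\<close>; \<open>\<epsilon> / 8\<close> keeps
    both displacements together within \<open>\<epsilon> / 4\<close>; \<open>1 / 2\<close> keeps the
    norms positive.\<close>
  define \<delta> where "\<delta> = Min {d / 2, \<epsilon> / 8, 1 / 2}"
  have \<delta>: "\<delta> > 0" "\<delta> \<le> d / 2" "\<delta> \<le> \<epsilon> / 8" "\<delta> \<le> 1 / 2"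
    using d \<open>\<epsilon> > 0\<close> by (auto simp: \<delta>_def)
  have near: "norm (x - x /\<^sub>R norm x) < \<delta>" if "norm x \<le> 1" "norm x > 1 - \<delta>" for x :: 'b
  proof -
    have "x - x /\<^sub>R norm x = (1 - inverse (norm x)) *\<^sub>R x" by (simp add: algebra_simps)
    then have "norm (x - x /\<^sub>R norm x) = \<bar>(1 - inverse (norm x)) * norm x\<bar>"
      by (simp add: abs_mult)
    also have "\<dots> = \<bar>norm x - 1\<bar>"
    proof -
      have "inverse (norm x) * norm x = 1" using that \<delta> by (intro left_inverse) linarith
      then show ?thesis by (simp add: left_diff_distrib)
    qed
    also have "\<dots> = 1 - norm x" using that by simp
    finally show ?thesis using that by simp
  qed
  have "norm (x - y) < \<epsilon>" if *: "norm x \<le> 1" "norm y \<le> 1" "norm (x + y) > 2 - \<delta>" for x y :: 'b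
  proof -
    define x' y' where "x' = x /\<^sub>R norm x" and "y' = y /\<^sub>R norm y"
    have n: "norm x > 1 - \<delta>" "norm y > 1 - \<delta>" using * norm_triangle_ineq[of x y] by linarith+
    then have "norm x > 0" "norm y > 0" using \<delta> by linarith+
    then have unit: "norm x' = 1" "norm y' = 1" by (auto simp: x'_def y'_def)
    have nr: "norm (x - x') < \<delta>" "norm (y - y') < \<delta>"
      using near n * by (auto simp: x'_def y'_def)
    have "norm (x' - y') < \<epsilon> / 2"
    proof (rule ccontr)
      assume "\<not> ?thesis"
      then have "norm ((1/2) *\<^sub>R (x' + y')) \<le> 1 - d" using d(2)[OF unit] by simp
      then have "norm (x' + y') \<le> 2 - 2 * d" by simp
      moreover have "norm (x + y) \<le> norm (x' + y') + norm (x - x') + norm (y - y')"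
        using norm_triangle_ineq[of "x' + y'" "(x - x') + (y - y')"]
          norm_triangle_ineq[of "x - x'" "y - y'"] by (simp add: algebra_simps)
      ultimately show False using nr * \<delta> d by linarith
    qed
    moreover have "norm (x - y) \<le> norm (x' - y') + norm (x - x') + norm (y - y')"
      using norm_triangle_ineq[of "x' - y'" "(x - x') - (y - y')"]
        norm_triangle_ineq4[of "x - x'" "y - y'"] by (simp add: algebra_simps)
    ultimately show ?thesis using nr \<delta> \<open>\<epsilon> > 0\<close> by linarith
  qed
  with that \<delta> show ?thesis by blast
qed

text \<open>If no point of the ball solved the inequalities for S, the alternative would give a
  convex combination v of S with \<open>blinfun_apply (L v) x \<le> F v - \<epsilon>\<close> on the
  ball, hence \<open>norm (L v) \<le> F v - \<epsilon>\<close>, against the bound on F. The map L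
  from an abstract space covers both later uses: all of the dual, and a subspace of the
  bidual.\<close>

lemma helly_unit_ball:
  fixes L :: "'w::real_vector \<Rightarrow> 'b::real_normed_vector dual" and F :: "'w \<Rightarrow> real"
  assumes L: "linear L" and F: "linear F" and bound: "\<And>u. F u \<le> norm (L u)"
    and "finite S" "\<epsilon> > 0"
  shows "\<exists>x. norm x \<le> 1 \<and> (\<forall>u\<in>S. \<bar>blinfun_apply (L u) x - F u\<bar> < \<epsilon>)"
proof -
  interpret L: linear L by (rule L)
  interpret F: linear F by (rule F)
  have one_sided: "\<exists>x. norm x \<le> 1 \<and> (\<forall>u\<in>S. F u - blinfun_apply (L u) x < \<epsilon>)" if S: "finite S" for S
  proof (rule ccontr)
    assume no: "\<not> ?thesis"
    define f where "f u x = F u - blinfun_apply (L u) x - \<epsilon>" for u x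
    have ex: "\<exists>u\<in>S. f u x \<ge> 0" if "x \<in> cball 0 1" for x
      using no that by (force simp: f_def)
    have "S \<noteq> {}" using ex[of 0] by auto
    have conv: "convex_on (cball 0 1) (f u)" for u
      by (rule convex_onI)
        (simp_all add: f_def blinfun.add_right blinfun.scaleR_right, simp add: algebra_simps)
    obtain l where l: "\<And>u. u \<in> S \<Longrightarrow> l u \<ge> 0" "sum l S = 1"
      "\<And>x. x \<in> cball 0 1 \<Longrightarrow> (\<Sum>u\<in>S. l u * f u x) \<ge> 0"
      using convex_alternative[OF S \<open>S \<noteq> {}\<close> convex_cball conv ex] by blast
    define v where "v = (\<Sum>u\<in>S. l u *\<^sub>R u)"
    have "blinfun_apply (L v) x \<le> F v - \<epsilon>" if "norm x \<le> 1" for x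
    proof -
      have "(\<Sum>u\<in>S. l u * f u x) = F v - blinfun_apply (L v) x - \<epsilon> * sum l S"
        by (simp add: v_def f_def L.sum L.scaleR F.sum F.scaleR blinfun.sum_left blinfun.scaleR_left
            sum_subtractf right_diff_distrib sum_distrib_left mult.commute)
      then show ?thesis using l(2) l(3)[of x] that by simp
    qed
    then have "norm (L v) \<le> F v - \<epsilon>" by (rule dual_norm_le)
    then show False using bound[of v] \<open>\<epsilon> > 0\<close> by simp
  qed
  \<comment> \<open>Closing S under negation turns the one-sided estimates into estimates of the
    absolute value.\<close>
  obtain x where x: "norm x \<le> 1" "\<And>u. u \<in> S \<union> uminus ` S \<Longrightarrow> F u - blinfun_apply (L u) x < \<epsilon>"
    using one_sided[of "S \<union> uminus ` S"] \<open>finite S\<close> by auto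
  show ?thesis
  proof (intro exI[of _ x] conjI ballI x)
    fix u assume "u \<in> S"
    then show "\<bar>blinfun_apply (L u) x - F u\<bar> < \<epsilon>"
      using x(2)[of u] x(2)[of "- u"] by (auto simp: L.neg F.neg blinfun.minus_left)
  qed
qed

text \<open>Approximate solutions in the unit ball of finitely many of the equations are forced together
  by an equation whose functional almost attains the norm, so they form a Cauchy sequence.\<close>

lemma uniformly_convex_moment_unit:
  fixes L :: "'w::real_vector \<Rightarrow> 'b::banach dual" and F :: "'w \<Rightarrow> real"
  assumes uc: "uniformly_convex TYPE('b)"
    and L: "linear L" and F: "linear F" and bound: "\<And>u. F u \<le> norm (L u)"
    and attain: "\<And>\<epsilon>. \<epsilon> > 0 \<Longrightarrow> \<exists>u. norm (L u) \<le> 1 \<and> F u > 1 - \<epsilon>"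
  shows "\<exists>x. \<forall>u. blinfun_apply (L u) x = F u"
proof -
  have "\<forall>n::nat. \<exists>u. norm (L u) \<le> 1 \<and> F u > 1 - 1 / Suc n"
    using attain by simp
  then obtain u where u: "\<And>n. norm (L (u n)) \<le> 1" "\<And>n. F (u n) > 1 - 1 / Suc n" by metis
  \<comment> \<open>Besides the nearly norming \<open>u 0\<close>, ..., \<open>u n\<close>, each
    system contains one arbitrary further equation v. The former force all solutions together,
    whatever v is, so the limit of \<open>z n 0\<close> is also that of \<open>z n v\<close> and
    satisfies equation v exactly.\<close>
  have "\<forall>n v. \<exists>x. norm x \<le> 1 \<and> (\<forall>w\<in>insert v (u ` {..n}). \<bar>blinfun_apply (L w) x - F w\<bar> < 1 / Suc n)"
    by (intro allI helly_unit_ball[OF L F bound]) auto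
  then obtain z where z: "\<And>n v. norm (z n v) \<le> 1"
    "\<And>n v w. w \<in> insert v (u ` {..n}) \<Longrightarrow> \<bar>blinfun_apply (L w) (z n v) - F w\<bar> < 1 / Suc n"
    by metis
  have close: "\<exists>N. \<forall>m\<ge>N. \<forall>n\<ge>N. \<forall>v w. norm (z m v - z n w) < \<epsilon>" if "\<epsilon> > 0" for \<epsilon>
  proof -
    obtain \<delta> where \<delta>: "\<delta> > 0"
      "\<And>x y :: 'b. norm x \<le> 1 \<Longrightarrow> norm y \<le> 1 \<Longrightarrow> norm (x + y) > 2 - \<delta> \<Longrightarrow> norm (x - y) < \<epsilon>"
      using uniformly_convex_unit_ball[OF uc \<open>\<epsilon> > 0\<close>] by blast
    obtain N where N: "1 / Suc N < \<delta> / 4"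
      using nat_approx_posE[of "\<delta> / 4"] \<delta>(1) by auto
    have val: "blinfun_apply (L (u N)) (z m v) > 1 - \<delta> / 2" if "m \<ge> N" for m v
    proof -
      have "1 / real (Suc m) \<le> 1 / Suc N" using that by (simp add: frac_le)
      moreover have "\<bar>blinfun_apply (L (u N)) (z m v) - F (u N)\<bar> < 1 / Suc m"
        using that by (intro z(2)) auto
      ultimately show ?thesis using u(2)[of N] N by linarith
    qed
    have "norm (z m v - z n w) < \<epsilon>" if "m \<ge> N" "n \<ge> N" for m n v w
    proof (rule \<delta>(2)[OF z(1) z(1)])
      have "2 - \<delta> < blinfun_apply (L (u N)) (z m v + z n w)"
        using val[of m v] val[of n w] that by (simp add: blinfun.add_right)
      also have "\<dots> \<le> norm (L (u N)) * norm (z m v + z n w)"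
        by (rule blinfun_apply_le)
      also have "\<dots> \<le> 1 * norm (z m v + z n w)"
        by (intro mult_right_mono u) auto
      finally show "2 - \<delta> < norm (z m v + z n w)" by simp
    qed
    then show ?thesis by blast
  qed
  have "Cauchy (\<lambda>n. z n 0)"
  proof (rule metric_CauchyI)
    fix e :: real assume "e > 0"
    from close[OF this] show "\<exists>M. \<forall>m\<ge>M. \<forall>n\<ge>M. dist (z m 0) (z n 0) < e"
      unfolding dist_norm by blast
  qed
  then obtain x where x: "(\<lambda>n. z n 0) \<longlonglongrightarrow> x" by (auto simp: Cauchy_convergent_iff convergent_def)
  have "blinfun_apply (L w) x = F w" for w
  proof (rule LIMSEQ_unique)
    have "(\<lambda>n. z n w - z n 0) \<longlonglongrightarrow> 0"
    proof (rule LIMSEQ_I)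
      fix r :: real assume "r > 0"
      from close[OF this] show "\<exists>N. \<forall>n\<ge>N. norm (z n w - z n 0 - 0) < r"
        unfolding diff_0_right by blast
    qed
    from tendsto_add[OF this x] have "(\<lambda>n. z n w) \<longlonglongrightarrow> x" by simp
    then show "(\<lambda>n. blinfun_apply (L w) (z n w)) \<longlonglongrightarrow> blinfun_apply (L w) x"
      by (intro tendsto_intros)
    have "(\<lambda>n. blinfun_apply (L w) (z n w) - F w) \<longlonglongrightarrow> 0"
    proof (rule Lim_null_comparison)
      show "\<forall>\<^sub>F n in sequentially. norm (blinfun_apply (L w) (z n w) - F w) \<le> 1 / Suc n"
        using z(2) by (auto intro!: always_eventually less_imp_le)
      show "(\<lambda>n. 1 / real (Suc n)) \<longlonglongrightarrow> 0" using LIMSEQ_inverse_real_of_nat by (simp add: inverse_eq_divide)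
    qed
    then show "(\<lambda>n. blinfun_apply (L w) (z n w)) \<longlonglongrightarrow> F w" using LIM_zero_iff by blast
  qed
  then show ?thesis by blast
qed

text \<open>Rescaling by the norm M of F relative to L, the supremum of F over
  \<open>norm (L u) \<le> 1\<close>, reduces to the case in which F nearly attains 1. If F is not
  identically 0 then M is positive.\<close>

lemma uniformly_convex_moment:
  fixes L :: "'w::real_vector \<Rightarrow> 'b::banach dual" and F :: "'w \<Rightarrow> real"
  assumes uc: "uniformly_convex TYPE('b)"
    and L: "linear L" and F: "linear F" and bound: "\<And>u. F u \<le> K * norm (L u)"
  shows "\<exists>x. \<forall>u. blinfun_apply (L u) x = F u"
proof (cases "\<forall>u. F u = 0")
  case True
  then show ?thesis by (intro exI[of _ 0]) auto
next
  case False
  interpret L: linear L by (rule L)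
  interpret F: linear F by (rule F)
  define A where "A = {F u | u. norm (L u) \<le> 1}"
  define M where "M = Sup A"
  have "F u \<le> \<bar>K\<bar>" if "norm (L u) \<le> 1" for u
  proof -
    have "F u \<le> K * norm (L u)" by (rule bound)
    also have "\<dots> \<le> \<bar>K\<bar> * norm (L u)" by (intro mult_right_mono) auto
    also have "\<dots> \<le> \<bar>K\<bar> * 1" using that by (intro mult_left_mono) auto
    finally show ?thesis by simp
  qed
  then have bdd: "bdd_above A" by (auto simp: A_def bdd_above_def)
  have "0 \<in> A" unfolding A_def by (auto intro!: exI[of _ 0] simp: L.zero F.zero)
  have upper: "F u \<le> M * norm (L u)" for u
  proof (cases "L u = 0")
    case True
    then show ?thesis using bound[of u] by simp
  next
    case False
    then have "F (u /\<^sub>R norm (L u)) \<in> A" by (auto simp: A_def L.scaleR)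
    then have "F (u /\<^sub>R norm (L u)) \<le> M" unfolding M_def by (rule cSup_upper[OF _ bdd])
    then show ?thesis using False by (simp add: F.scaleR field_simps)
  qed
  obtain u1 where "F u1 > 0"
  proof -
    from False obtain v where "F v \<noteq> 0" by blast
    then have "F v > 0 \<or> F (- v) > 0" by (auto simp: F.neg)
    then show ?thesis using that by blast
  qed
  with upper[of u1] have "M * norm (L u1) > 0" by linarith
  then have M: "M > 0" by (simp add: zero_less_mult_iff)
  have "\<exists>x. \<forall>u. blinfun_apply (L u) x = F u / M"
  proof (rule uniformly_convex_moment_unit[OF uc L])
    show "linear (\<lambda>u. F u / M)"
      by (intro linearI) (auto simp: F.add F.scaleR add_divide_distrib)
    show "F u / M \<le> norm (L u)" for u using upper[of u] M by (simp add: field_simps)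
    fix \<epsilon> :: real assume "\<epsilon> > 0"
    then have "M * (1 - \<epsilon>) < Sup A" unfolding M_def[symmetric] using M by (simp add: algebra_simps)
    then obtain a where "a \<in> A" "M * (1 - \<epsilon>) < a"
      using less_cSupD[of A] \<open>0 \<in> A\<close> by blast
    then show "\<exists>u. norm (L u) \<le> 1 \<and> F u / M > 1 - \<epsilon>"
      using M by (auto simp: A_def field_simps)
  qed
  then obtain x where "\<And>u. blinfun_apply (L u) x = F u / M" by blast
  then show ?thesis using M by (intro exI[of _ "M *\<^sub>R x"]) (auto simp: blinfun.scaleR_right)
qed

text \<open>A point of the bidual is a consistent bounded system of moments for all functionals at
  once, so the moment lemma applies with L the identity.\<close>

lemma milman_pettis:
  assumes "uniformly_convex TYPE('a::banach)"
  shows "surj (bidual_embed :: 'a \<Rightarrow> _)"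
proof -
  have "\<exists>x. bidual_embed x = \<xi>" for \<xi> :: "'a dual dual"
  proof -
    have "\<exists>x. \<forall>y. blinfun_apply (id y) x = blinfun_apply \<xi> y"
    proof (rule uniformly_convex_moment[OF assms])
      show "linear (id :: 'a dual \<Rightarrow> 'a dual)" by (rule linear_id)
      show "linear (blinfun_apply \<xi>)" by (simp add: blinfun.bounded_linear_right bounded_linear.linear)
      show "blinfun_apply \<xi> y \<le> norm \<xi> * norm (id y)" for y by (simp add: blinfun_apply_le)
    qed
    then obtain x where "\<And>y. blinfun_apply y x = blinfun_apply \<xi> y" by auto
    then show ?thesis by (intro exI[of _ x] blinfun_eqI) simp
  qed
  then show ?thesis by (metis surjI)
qed

lemma bounded_linear_bidual_embed: "bounded_linear (bidual_embed :: 'a::real_normed_vector \<Rightarrow> _)"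
proof (rule bounded_linear_intro[where K = 1])
  show "norm (bidual_embed x) \<le> norm x * 1" for x :: 'a
    by (intro norm_blinfun_bound) (auto simp: norm_blinfun mult.commute[of "norm x"] simp flip: real_norm_def)
qed (auto intro!: blinfun_eqI simp: blinfun.add_left blinfun.add_right blinfun.scaleR_left blinfun.scaleR_right)

text \<open>If the closed subspace \<open>'a\<close> missed a point \<open>\<xi>\<close> of the bidual, then a point of the dual would
  annihilate \<open>'a\<close>, that is, be zero, without annihilating \<open>\<xi>\<close>.\<close>

lemma reflexive_if_uniformly_convex_dual:
  assumes uc: "uniformly_convex TYPE('a::banach dual)"
    and iso: "\<And>x :: 'a. norm x \<le> norm (bidual_embed x)"
  shows "surj (bidual_embed :: 'a \<Rightarrow> _)"
proof (rule ccontr)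
  assume "\<not> ?thesis"
  then obtain \<xi> where \<xi>: "\<xi> \<notin> range (bidual_embed :: 'a \<Rightarrow> _)" by blast
  interpret E: bounded_linear "bidual_embed :: 'a \<Rightarrow> _" by (rule bounded_linear_bidual_embed)
  have "complete (range (bidual_embed :: 'a \<Rightarrow> _))"
    by (rule complete_isometric_image[of 1]) (use iso complete_UNIV bounded_linear_bidual_embed in auto)
  then have "open (- range (bidual_embed :: 'a \<Rightarrow> _))"
    using complete_imp_closed by blast
  then obtain d where d: "d > 0" "ball \<xi> d \<subseteq> - range (bidual_embed :: 'a \<Rightarrow> _)"
    using \<xi> by (metis ComplI open_contains_ball)
  define L where "L = (\<lambda>(x::'a, t::real). bidual_embed x + t *\<^sub>R \<xi>)"
  have far: "norm (\<xi> - bidual_embed x) \<ge> d" for x :: 'a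
  proof (rule ccontr)
    assume "\<not> ?thesis"
    then have "bidual_embed x \<in> ball \<xi> d" by (simp add: dist_norm)
    with d(2) show False by blast
  qed
  \<comment> \<open>On the span of the embedded space and \<open>\<xi>\<close>, the functional that
    vanishes on the former and is 1 at \<open>\<xi>\<close> is bounded by \<open>1 / d\<close>, as
    \<open>\<xi>\<close> has distance at least d from the subspace. Uniform convexity of the dual
    represents it by some f.\<close>
  have "\<exists>f. \<forall>u. blinfun_apply (L u) f = snd u"
  proof (rule uniformly_convex_moment[OF uc])
    show "linear L"
      by (rule linearI) (auto simp: L_def E.add E.scaleR algebra_simps)
    show "linear (snd :: 'a \<times> real \<Rightarrow> real)" by (rule linear_snd)
    fix u :: "'a \<times> real"
    obtain x t where u: "u = (x, t)" by force
    have "\<bar>t\<bar> * d \<le> norm (L u)"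
    proof (cases "t = 0")
      case False
      have "L u = t *\<^sub>R (\<xi> - bidual_embed ((- 1 / t) *\<^sub>R x))"
        using False by (simp add: L_def u E.scaleR E.neg algebra_simps)
      then have "norm (L u) = \<bar>t\<bar> * norm (\<xi> - bidual_embed ((- 1 / t) *\<^sub>R x))" by simp
      then show ?thesis using far by (simp add: mult_left_mono)
    qed simp
    then have "t * d \<le> norm (L u)" using d(1) by (smt (verit) mult_right_mono)
    then show "snd u \<le> (1 / d) * norm (L u)" using d(1) by (simp add: u field_simps)
  qed
  then obtain f where f: "\<And>u. blinfun_apply (L u) f = snd u" by blast
  have "blinfun_apply f x = 0" for x
    using f[of "(x, 0)"] by (simp add: L_def)
  then have "f = 0" by (intro blinfun_eqI) simp
  then show False using f[of "(0, 1)"] by (simp add: L_def E.zero)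
qed

text \<open>If \<open>f + g\<close> nearly attains norm 2 at x, testing f at
  \<open>x + \<tau> *\<^sub>R h\<close> and g at \<open>x - \<tau> *\<^sub>R h\<close> bounds
  \<open>f - g\<close> in direction h by the second-order difference of the norm, which uniform
  smoothness makes small compared with \<open>\<tau>\<close>.\<close>

lemma uniformly_frechet_smooth_imp_uniformly_convex_dual:
  assumes "uniformly_frechet_smooth TYPE('a::real_normed_vector)"
  shows "uniformly_convex TYPE('a dual)"
  unfolding uniformly_convex_def
proof (intro allI impI)
  fix \<epsilon> :: real assume "\<epsilon> > 0"
  obtain D :: "'a \<Rightarrow> 'a dual" where D: "uniform_limit (sphere 0 1 \<times> sphere 0 1)
        (\<lambda>t (x, h). (norm (x + t *\<^sub>R h) - norm x) / t)
        (\<lambda>(x, h). blinfun_apply (D x) h) (at 0)"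
    using assms unfolding uniformly_frechet_smooth_def by blast
  have "\<forall>\<^sub>F t in at 0. \<forall>p\<in>sphere 0 1 \<times> sphere 0 1.
      dist ((\<lambda>(x, h). (norm (x + t *\<^sub>R h) - norm x) / t) p) ((\<lambda>(x, h). blinfun_apply (D x) h) p) < \<epsilon> / 8"
    using uniform_limitD[OF D, of "\<epsilon> / 8"] \<open>\<epsilon> > 0\<close> by simp
  then obtain t0 where t0: "t0 > 0" "\<And>t x h. t \<noteq> 0 \<Longrightarrow> \<bar>t\<bar> < t0 \<Longrightarrow> norm x = 1 \<Longrightarrow> norm h = 1 \<Longrightarrow>
      \<bar>(norm (x + t *\<^sub>R h) - 1) / t - blinfun_apply (D x) h\<bar> < \<epsilon> / 8"
    unfolding eventually_at by (auto simp: dist_real_def)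
  define \<tau> where "\<tau> = t0 / 2"
  have \<tau>: "\<tau> > 0" using t0 by (simp add: \<tau>_def)
  \<comment> \<open>The quotients at \<open>\<tau>\<close> and \<open>- \<tau>\<close> share one
    derivative, which cancels in the sum; the two errors \<open>\<tau> * \<epsilon> / 8\<close> add
    up.\<close>
  have modulus: "norm (x + \<tau> *\<^sub>R h) + norm (x - \<tau> *\<^sub>R h) \<le> 2 + \<tau> * \<epsilon> / 4"
    if "norm x = 1" "norm h = 1" for x h :: 'a
  proof -
    have small: "\<tau> \<noteq> 0" "\<bar>\<tau>\<bar> < t0" using t0(1) by (auto simp: \<tau>_def)
    have "\<bar>(norm (x + \<tau> *\<^sub>R h) - 1) / \<tau> - blinfun_apply (D x) h\<bar> < \<epsilon> / 8"
      using t0(2) small that by blast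
    moreover have "\<bar>(norm (x - \<tau> *\<^sub>R h) - 1) / - \<tau> - blinfun_apply (D x) h\<bar> < \<epsilon> / 8"
      using t0(2)[of "- \<tau>" x h] small that by (simp del: divide_minus_right)
    ultimately have "(norm (x + \<tau> *\<^sub>R h) - 1) / \<tau> < blinfun_apply (D x) h + \<epsilon> / 8"
      "(norm (x - \<tau> *\<^sub>R h) - 1) / - \<tau> > blinfun_apply (D x) h - \<epsilon> / 8"
      by linarith+
    then have "norm (x + \<tau> *\<^sub>R h) - 1 < \<tau> * blinfun_apply (D x) h + \<tau> * \<epsilon> / 8"
      "norm (x - \<tau> *\<^sub>R h) - 1 < - \<tau> * blinfun_apply (D x) h + \<tau> * \<epsilon> / 8"
      using \<tau> by (auto simp: field_simps)
    then show ?thesis by simp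
  qed
  \<comment> \<open>The defect \<open>2 * \<delta>\<close> of \<open>f + g\<close> at x then equals
    at most the error \<open>\<tau> * \<epsilon> / 4\<close> of the norm, so that dividing by
    \<open>\<tau>\<close> leaves \<open>\<epsilon> / 2\<close>. The bound \<open>1 / 2\<close> makes
    \<open>f + g\<close> positive at \<open>x0\<close>, whence normalising \<open>x0\<close> does
    not decrease the value.\<close>
  define \<delta> where "\<delta> = min (\<tau> * \<epsilon> / 8) (1 / 2)"
  have \<delta>: "\<delta> > 0" "\<delta> \<le> \<tau> * \<epsilon> / 8" "\<delta> \<le> 1 / 2" using \<tau> \<open>\<epsilon> > 0\<close> by (simp_all add: \<delta>_def)
  have "norm (f - g) < \<epsilon>"
    if fg: "norm f = 1" "norm g = 1" "norm ((1/2) *\<^sub>R (f + g)) > 1 - \<delta>" for f g :: "'a dual"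
  proof -
    have "norm (f + g) > 2 - 2 * \<delta>" using fg(3) by simp
    then obtain x0 where x0: "norm x0 \<le> 1" "blinfun_apply (f + g) x0 > 2 - 2 * \<delta>"
      using dual_norm_le[of "f + g" "2 - 2 * \<delta>"] by (meson not_le)
    then have pos: "blinfun_apply (f + g) x0 > 0" using \<delta> by linarith
    then have "x0 \<noteq> 0" by auto
    define x where "x = x0 /\<^sub>R norm x0"
    have "norm x = 1" using \<open>x0 \<noteq> 0\<close> by (simp add: x_def)
    have "blinfun_apply (f + g) x0 \<le> blinfun_apply (f + g) x0 / norm x0"
      using pos x0(1) \<open>x0 \<noteq> 0\<close> by (simp add: field_simps)
    also have "\<dots> = blinfun_apply (f + g) x"
      by (simp add: x_def blinfun.scaleR_right field_simps)
    finally have "blinfun_apply (f + g) x > 2 - 2 * \<delta>" using x0(2) by linarith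
    note x = \<open>norm x = 1\<close> this
    have "norm (f - g) \<le> \<epsilon> / 2"
    proof (rule dual_norm_le)
      fix y :: 'a assume y: "norm y \<le> 1"
      show "blinfun_apply (f - g) y \<le> \<epsilon> / 2"
      proof (cases "y = 0")
        case False
        define h where "h = y /\<^sub>R norm y"
        have h: "norm h = 1" using False by (simp add: h_def)
        have "blinfun_apply f (x + \<tau> *\<^sub>R h) \<le> norm (x + \<tau> *\<^sub>R h)"
          "blinfun_apply g (x - \<tau> *\<^sub>R h) \<le> norm (x - \<tau> *\<^sub>R h)"
          using blinfun_apply_le[of f] blinfun_apply_le[of g] fg by (metis mult_1)+
        then have "blinfun_apply (f + g) x + \<tau> * blinfun_apply (f - g) h \<le> 2 + \<tau> * \<epsilon> / 4"
          using modulus[OF x(1) h]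
          by (simp add: blinfun.add_left blinfun.diff_left blinfun.add_right blinfun.diff_right
              blinfun.scaleR_right right_diff_distrib)
        then have "\<tau> * blinfun_apply (f - g) h \<le> \<tau> * (\<epsilon> / 2)"
          using x(2) \<delta>(2) by simp
        then have le: "blinfun_apply (f - g) h \<le> \<epsilon> / 2" using \<tau> by simp
        have "blinfun_apply (f - g) y = norm y * blinfun_apply (f - g) h"
          using False by (simp add: h_def blinfun.scaleR_right)
        also have "\<dots> \<le> 1 * (\<epsilon> / 2)"
          by (rule order_trans[OF mult_left_mono[OF le norm_ge_zero] mult_right_mono[OF y]])
            (use \<open>\<epsilon> > 0\<close> in simp)
        finally show ?thesis by simp
      qed (use \<open>\<epsilon> > 0\<close> in auto)
    qed
    then show ?thesis using \<open>\<epsilon> > 0\<close> by simp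
  qed
  then show "\<exists>\<delta>>0. \<forall>f g :: 'a dual. norm f = 1 \<longrightarrow> norm g = 1 \<longrightarrow> norm (f - g) \<ge> \<epsilon> \<longrightarrow>
      norm ((1/2) *\<^sub>R (f + g)) \<le> 1 - \<delta>"
    using \<delta> by (intro exI[of _ \<delta>]) (auto simp: not_less[symmetric])
qed

section \<open>Weak cluster points of bounded families\<close>

text \<open>The functionals lie in a product of compact intervals; a cluster point of their image
  filter for pointwise convergence is again linear and bounded by R. A finer filter U plays the role
  of a subnet, so that all later limits are ordinary limits along U.\<close>

lemma banach_alaoglu_cluster:
  fixes w :: "'i \<Rightarrow> 'b::real_normed_vector dual"
  assumes "F \<noteq> bot" and bound: "eventually (\<lambda>i. norm (w i) \<le> R) F"
  obtains U v where "U \<le> F" "U \<noteq> bot" "\<And>x. ((\<lambda>i. blinfun_apply (w i) x) \<longlongrightarrow> blinfun_apply v x) U"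
proof -
  define K where "K = Pi\<^sub>E UNIV (\<lambda>x::'b. {- (R * norm x) .. R * norm x})"
  have K: "compact K"
    unfolding K_def
    using compactin_PiE[of "\<lambda>_::'b. euclidean :: real topology" UNIV "\<lambda>x. {- (R * norm x) .. R * norm x}"]
    by (simp add: euclidean_product_topology)
  define G where "G = filtermap (\<lambda>i. blinfun_apply (w i)) F"
  have "eventually (\<lambda>i. blinfun_apply (w i) \<in> K) F"
    using bound
  proof eventually_elim
    case (elim i)
    have "\<bar>blinfun_apply (w i) x\<bar> \<le> R * norm x" for x
      using norm_blinfun[of "w i" x] mult_right_mono[OF elim, of "norm x"] by simp
    then show ?case by (auto simp: K_def abs_le_iff minus_le_iff)
  qed
  then have "G \<le> principal K" "G \<noteq> bot"
    using \<open>F \<noteq> bot\<close> by (auto simp: G_def le_principal eventually_filtermap filtermap_bot_iff)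
  then obtain g where g: "g \<in> K" "inf (nhds g) G \<noteq> bot"
    using K unfolding compact_filter le_principal by blast
  \<comment> \<open>Intersecting F with the preimages of the neighbourhoods of g forces convergence
    to g, and U is proper because g is a cluster point.\<close>
  define U where "U = inf F (filtercomap (\<lambda>i. blinfun_apply (w i)) (nhds g))"
  have "U \<noteq> bot"
  proof
    assume "U = bot"
    then have "eventually (\<lambda>_. False) U" by simp
    then obtain P Q where PQ: "eventually P F" "eventually Q (nhds g)"
      "\<And>i. P i \<Longrightarrow> Q (blinfun_apply (w i)) \<Longrightarrow> False"
      unfolding U_def eventually_inf eventually_filtercomap by blast
    have "eventually (\<lambda>h. \<not> Q h) G"
      unfolding G_def eventually_filtermap using PQ(1) by eventually_elim (use PQ(3) in blast)
    with PQ(2) have "eventually (\<lambda>_. False) (inf (nhds g) G)"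
      unfolding eventually_inf by blast
    with g(2) show False by (simp add: trivial_limit_def)
  qed
  have "U \<le> filtercomap (\<lambda>i. blinfun_apply (w i)) (nhds g)" by (simp add: U_def)
  then have "filterlim (\<lambda>i. blinfun_apply (w i)) (nhds g) U"
    by (simp add: filterlim_iff_le_filtercomap)
  then have lim_fun: "((\<lambda>i. blinfun_apply (w i)) \<longlongrightarrow> g) U" .
  have lim: "((\<lambda>i. blinfun_apply (w i) x) \<longlongrightarrow> g x) U" for x
  proof (rule topological_tendstoI)
    fix S :: "real set" assume S: "open S" "g x \<in> S"
    have "open ((\<lambda>h :: 'b \<Rightarrow> real. h x) -` S)"
      by (intro open_vimage S continuous_on_product_coordinates)
    from topological_tendstoD[OF lim_fun this] S
    show "\<forall>\<^sub>F i in U. blinfun_apply (w i) x \<in> S" by simp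
  qed
  have add: "g (x + y) = g x + g y" for x y
    using tendsto_unique[OF \<open>U \<noteq> bot\<close> lim[of "x + y"]] tendsto_add[OF lim lim, of x y]
    by (simp add: blinfun.add_right)
  have scale: "g (c *\<^sub>R x) = c *\<^sub>R g x" for c x
    using tendsto_unique[OF \<open>U \<noteq> bot\<close> lim[of "c *\<^sub>R x"]] tendsto_scaleR[OF tendsto_const lim, of c x]
    by (simp add: blinfun.scaleR_right)
  have "bounded_linear g"
  proof (rule bounded_linear_intro[OF add scale, where K = R])
    show "norm (g x) \<le> norm x * R" for x
      using g(1) by (auto simp: K_def PiE_iff abs_le_iff mult.commute minus_le_iff)
  qed
  then have "blinfun_apply (Blinfun g) = g" by (rule bounded_linear_Blinfun_apply)
  then show ?thesis using that[of U "Blinfun g"] \<open>U \<noteq> bot\<close> lim by (simp add: U_def)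
qed

text \<open>Clustering takes place in the bidual, and reflexivity brings the cluster point back to
  the space.\<close>

lemma reflexive_weak_cluster:
  fixes u :: "'i \<Rightarrow> 'a::real_normed_vector"
  assumes refl: "surj (bidual_embed :: 'a \<Rightarrow> _)"
    and "F \<noteq> bot" and bound: "eventually (\<lambda>i. norm (u i) \<le> R) F"
  obtains U x where "U \<le> F" "U \<noteq> bot"
    "\<And>y :: 'a dual. ((\<lambda>i. blinfun_apply y (u i)) \<longlongrightarrow> blinfun_apply y x) U"
proof -
  have "norm (bidual_embed x) \<le> norm x" for x :: 'a
    by (intro norm_blinfun_bound) (auto simp: norm_blinfun mult.commute[of "norm x"] simp flip: real_norm_def)
  then have "eventually (\<lambda>i. norm (bidual_embed (u i)) \<le> R) F"
    using bound by (auto elim!: eventually_mono intro: order_trans)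
  from banach_alaoglu_cluster[OF \<open>F \<noteq> bot\<close> this] obtain U \<xi> where
    U: "U \<le> F" "U \<noteq> bot" "\<And>y. ((\<lambda>i. blinfun_apply (bidual_embed (u i)) y) \<longlongrightarrow> blinfun_apply \<xi> y) U"
    by blast
  from refl obtain x where "\<xi> = bidual_embed x" by blast
  then have "((\<lambda>i. blinfun_apply y (u i)) \<longlongrightarrow> blinfun_apply y x) U" for y :: "'a dual"
    using U(3)[of y] by simp
  then show ?thesis by (rule that[OF U(1,2)])
qed

section \<open>Subgradients and Gateaux derivatives of convex functions\<close>

lemma gateaux_derivs_DERIV:
  "D \<in> gateaux_derivs f x \<longleftrightarrow> (\<forall>h. ((\<lambda>t. f (x + t *\<^sub>R h)) has_real_derivative blinfun_apply D h) (at 0))"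
  by (simp add: gateaux_derivs_def DERIV_def)

lemma has_derivative_imp_gateaux_derivs:
  assumes N: "(f has_derivative N) (at x)"
  shows "Blinfun N \<in> gateaux_derivs f x"
proof -
  have bl: "bounded_linear N" using N by (rule has_derivative_bounded_linear)
  have "((\<lambda>t. f (x + t *\<^sub>R h)) has_real_derivative N h) (at 0)" for h
  proof (rule has_derivative_imp_has_field_derivative)
    have "((\<lambda>t. x + t *\<^sub>R h) has_derivative (\<lambda>t. t *\<^sub>R h)) (at (0::real))"
      by (auto intro!: derivative_eq_intros)
    from has_derivative_compose[OF this, of f N] N
    show "((\<lambda>t. f (x + t *\<^sub>R h)) has_derivative (\<lambda>t. N (t *\<^sub>R h))) (at (0::real))" by simp
    show "t * N h = N (t *\<^sub>R h)" for t
      using bounded_linear.linear[OF bl] by (simp add: linear_cmul)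
  qed
  then show ?thesis
    by (simp add: gateaux_derivs_DERIV bounded_linear_Blinfun_apply[OF bl])
qed

lemma gateaux_deriv_subgradient:
  assumes f: "convex_on UNIV f" and D: "D \<in> gateaux_derivs f x"
  shows "f x + blinfun_apply D (y - x) \<le> f y"
proof -
  have "((\<lambda>t. (f (x + t *\<^sub>R (y - x)) - f x) / t) \<longlongrightarrow> blinfun_apply D (y - x)) (at_right 0)"
    using D by (auto simp: gateaux_derivs_def intro: tendsto_mono[OF at_le[OF subset_UNIV]])
  moreover have "eventually (\<lambda>t. (f (x + t *\<^sub>R (y - x)) - f x) / t \<le> f y - f x) (at_right 0)"
    using eventually_at_right_less[of 0] eventually_at_right_real[OF zero_less_one]
  proof eventually_elim
    case (elim t)
    have "f ((1 - t) *\<^sub>R x + t *\<^sub>R y) \<le> (1 - t) * f x + t * f y"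
      using elim by (intro convex_onD[OF f]) auto
    then have "f (x + t *\<^sub>R (y - x)) - f x \<le> t * (f y - f x)"
      by (simp add: algebra_simps)
    then show ?case using elim by (simp add: field_simps)
  qed
  ultimately have "blinfun_apply D (y - x) \<le> f y - f x"
    by (intro tendsto_upperbound) auto
  then show ?thesis by simp
qed

lemma subgradient_eq_gateaux_deriv:
  assumes D: "D \<in> gateaux_derivs f x" and w: "\<And>y. f x + blinfun_apply w (y - x) \<le> f y"
  shows "w = D"
proof (rule blinfun_eqI)
  have le: "blinfun_apply w h \<le> blinfun_apply D h" for h
  proof -
    have "((\<lambda>t. (f (x + t *\<^sub>R h) - f x) / t) \<longlongrightarrow> blinfun_apply D h) (at_right 0)"
      using D by (auto simp: gateaux_derivs_def intro: tendsto_mono[OF at_le[OF subset_UNIV]])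
    moreover have "eventually (\<lambda>t. blinfun_apply w h \<le> (f (x + t *\<^sub>R h) - f x) / t) (at_right 0)"
      using eventually_at_right_less[of 0]
    proof eventually_elim
      case (elim t)
      then show ?case using w[of "x + t *\<^sub>R h"] by (simp add: blinfun.scaleR_right field_simps)
    qed
    ultimately show ?thesis by (intro tendsto_lowerbound) auto
  qed
  show "blinfun_apply w h = blinfun_apply D h" for h
    using le[of h] le[of "- h"] by (simp add: blinfun.minus_right)
qed

section \<open>Smooth norms\<close>

text \<open>The common consequence of the two smoothness hypotheses; it makes the duality map
  single-valued.\<close>

definition gateaux_smooth :: "'a::real_normed_vector itself \<Rightarrow> bool"
  where "gateaux_smooth _ \<longleftrightarrow> (\<forall>x::'a. x \<noteq> 0 \<longrightarrow> gateaux_derivs norm x \<noteq> {})"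

lemma frechet_smooth_imp_gateaux_smooth:
  assumes "frechet_smooth TYPE('a::real_normed_vector)"
  shows "gateaux_smooth TYPE('a)"
  using assms has_derivative_imp_gateaux_derivs
  unfolding frechet_smooth_def gateaux_smooth_def differentiable_def by blast

text \<open>The hypothesis concerns unit points and unit directions only. By homogeneity of the
  norm, the quotient at x in direction h is \<open>norm h\<close> times the quotient at the
  normalised pair with step \<open>c * t\<close>, where \<open>c = norm h / norm x\<close>.\<close>

lemma uniformly_frechet_smooth_imp_gateaux_smooth:
  assumes "uniformly_frechet_smooth TYPE('a::real_normed_vector)"
  shows "gateaux_smooth TYPE('a)"
  unfolding gateaux_smooth_def
proof (intro allI impI)
  fix x :: 'a assume x: "x \<noteq> 0"
  obtain D :: "'a \<Rightarrow> 'a dual" where D: "uniform_limit (sphere 0 1 \<times> sphere 0 1)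
        (\<lambda>t (x, h). (norm (x + t *\<^sub>R h) - norm x) / t)
        (\<lambda>(x, h). blinfun_apply (D x) h) (at 0)"
    using assms unfolding uniformly_frechet_smooth_def by blast
  define x' where "x' = x /\<^sub>R norm x"
  have x': "norm x' = 1" "x = norm x *\<^sub>R x'" using x by (auto simp: x'_def)
  have "((\<lambda>t. (norm (x + t *\<^sub>R h) - norm x) / t) \<longlongrightarrow> blinfun_apply (D x') h) (at 0)" for h
  proof (cases "h = 0")
    case False
    define h' where "h' = h /\<^sub>R norm h"
    define c where "c = norm h / norm x"
    have h': "norm h' = 1" "h = norm h *\<^sub>R h'" and c: "c > 0"
      using False x by (auto simp: h'_def c_def)
    have "((\<lambda>t. (norm (x' + t *\<^sub>R h') - norm x') / t) \<longlongrightarrow> blinfun_apply (D x') h') (at 0)"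
      using tendsto_uniform_limitI[OF D, of "(x', h')"] x' h' by simp
    moreover have "filterlim (\<lambda>t. c * t) (at 0) (at (0::real))"
      using c by (auto simp: filterlim_at intro!: tendsto_eq_intros)
        (auto simp: eventually_at intro!: exI[of _ 1])
    ultimately have "((\<lambda>t. (norm (x' + (c * t) *\<^sub>R h') - norm x') / (c * t)) \<longlongrightarrow> blinfun_apply (D x') h') (at 0)"
      by (rule filterlim_compose)
    then have "((\<lambda>t. norm h * ((norm (x' + (c * t) *\<^sub>R h') - norm x') / (c * t))) \<longlongrightarrow>
        norm h * blinfun_apply (D x') h') (at 0)"
      by (intro tendsto_intros)
    moreover have "norm h * ((norm (x' + (c * t) *\<^sub>R h') - norm x') / (c * t)) =
        (norm (x + t *\<^sub>R h) - norm x) / t" for t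
    proof -
      have "x + t *\<^sub>R h = norm x *\<^sub>R (x' + (c * t) *\<^sub>R h')"
      proof -
        have "norm x *\<^sub>R (x' + (c * t) *\<^sub>R h') = norm x *\<^sub>R x' + t *\<^sub>R (norm h *\<^sub>R h')"
          using x by (simp add: c_def scaleR_add_right mult.commute)
        then show ?thesis by (simp flip: x'(2) h'(2))
      qed
      then have "norm (x + t *\<^sub>R h) = norm x * norm (x' + (c * t) *\<^sub>R h')" by simp
      then show ?thesis using x False x' by (simp add: c_def divide_simps) (simp add: algebra_simps)
    qed
    moreover have "norm h * blinfun_apply (D x') h' = blinfun_apply (D x') h"
      using False by (simp add: h'_def blinfun.scaleR_right)
    ultimately show ?thesis by simp
  qed simp
  then have "D x' \<in> gateaux_derivs norm x" by (simp add: gateaux_derivs_def)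
  then show "gateaux_derivs norm x \<noteq> {}" by blast
qed

section \<open>The potential of a gauge\<close>

locale gauge_potential =
  fixes \<phi> :: "real \<Rightarrow> real"
  assumes gauge: "gauge_fun \<phi>"
begin

definition G :: "real \<Rightarrow> real" where "G r = integral {0..r} \<phi>"

lemma potential_G: "potential \<phi> x = G (norm x)"
  by (simp add: potential_def G_def)

lemma phi_zero: "\<phi> 0 = 0"
  using gauge by (simp add: gauge_fun_def)

lemma phi_less: "0 \<le> s \<Longrightarrow> s < t \<Longrightarrow> \<phi> s < \<phi> t"
  using gauge by (auto simp: gauge_fun_def strict_mono_on_def)

lemma phi_mono: "0 \<le> s \<Longrightarrow> s \<le> t \<Longrightarrow> \<phi> s \<le> \<phi> t"
  using phi_less[of s t] by (cases "s = t") auto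

lemma phi_nonneg: "0 \<le> t \<Longrightarrow> 0 \<le> \<phi> t"
  using phi_mono[of 0 t] phi_zero by simp

lemma phi_continuous: "continuous_on {0..} \<phi>"
  using gauge by (simp add: gauge_fun_def)

lemma phi_tendsto:
  assumes "(u \<longlongrightarrow> r) F" "eventually (\<lambda>i. u i \<ge> 0) F" "r \<ge> 0"
  shows "((\<lambda>i. \<phi> (u i)) \<longlongrightarrow> \<phi> r) F"
  using continuous_on_tendsto_compose[OF phi_continuous assms(1)] assms by simp

lemma phi_unbounded: "\<exists>s\<ge>0. \<phi> s \<ge> m"
proof -
  have "eventually (\<lambda>s. \<phi> s \<ge> m) at_top"
    using gauge by (auto simp: gauge_fun_def filterlim_at_top)
  then obtain N where "\<And>s. s \<ge> N \<Longrightarrow> \<phi> s \<ge> m" by (auto simp: eventually_at_top_linorder)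
  then show ?thesis by (intro exI[of _ "max N 0"]) auto
qed

lemma phi_integrable: "0 \<le> a \<Longrightarrow> \<phi> integrable_on {a..b}"
  by (intro integrable_continuous_real continuous_on_subset[OF phi_continuous]) auto

lemma G_subgradient:
  assumes "r \<ge> 0" "s \<ge> 0"
  shows "G r + \<phi> r * (s - r) \<le> G s"
proof (cases "r \<le> s")
  case True
  have "G r + integral {r..s} \<phi> = G s"
    unfolding G_def by (rule Henstock_Kurzweil_Integration.integral_combine) (use True assms phi_integrable in auto)
  moreover have "integral {r..s} (\<lambda>_. \<phi> r) \<le> integral {r..s} \<phi>"
    by (rule integral_le) (use assms phi_integrable phi_mono in auto)
  ultimately show ?thesis using True by (simp add: mult.commute)
next
  case False
  have "G s + integral {s..r} \<phi> = G r"
    unfolding G_def by (rule Henstock_Kurzweil_Integration.integral_combine) (use False assms phi_integrable in auto)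
  moreover have "integral {s..r} \<phi> \<le> integral {s..r} (\<lambda>_. \<phi> r)"
    by (rule integral_le) (use assms phi_integrable phi_mono in auto)
  ultimately show ?thesis using False by (simp add: algebra_simps)
qed

lemma G_zero: "G 0 = 0"
  by (simp add: G_def)

lemma G_nonneg: "r \<ge> 0 \<Longrightarrow> G r \<ge> 0"
  using G_subgradient[of 0 r] by (simp add: G_zero phi_zero)

lemma G_mono: "0 \<le> r \<Longrightarrow> r \<le> s \<Longrightarrow> G r \<le> G s"
  using G_subgradient[of r s] mult_nonneg_nonneg[OF phi_nonneg[of r], of "s - r"] by simp

lemma G_deriv:
  assumes "r > 0"
  shows "(G has_real_derivative \<phi> r) (at r)"
proof -
  have "((\<lambda>s. integral {0..s} \<phi>) has_real_derivative \<phi> r) (at r within {0..r+1})"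
    by (rule integral_has_real_derivative)
      (use assms in \<open>auto intro: continuous_on_subset[OF phi_continuous]\<close>)
  moreover have "at r within {0..r+1} = at r"
    by (rule at_within_interior) (use assms in \<open>auto simp: interior_atLeastAtMost_real\<close>)
  ultimately show ?thesis unfolding G_def[abs_def] by simp
qed

text \<open>As \<open>\<phi>\<close> is unbounded, some supporting line of G has slope at least
  m.\<close>

lemma G_coercive: "\<exists>K. \<forall>r\<ge>0. m * r \<le> G r + K"
proof -
  obtain s where s: "s \<ge> 0" "\<phi> s \<ge> m" using phi_unbounded by blast
  have "m * r \<le> G r + \<phi> s * s" if "r \<ge> 0" for r
  proof -
    have "m * r \<le> \<phi> s * r" using s that by (simp add: mult_right_mono)
    then show ?thesis
      using G_subgradient[OF s(1) that] G_nonneg[OF s(1)] by (simp add: algebra_simps)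
  qed
  then show ?thesis by blast
qed

lemma potential_zero: "potential \<phi> 0 = 0"
  by (simp add: potential_G G_zero)

lemma potential_nonneg: "potential \<phi> x \<ge> 0"
  by (simp add: potential_G G_nonneg)

lemma potential_convex: "convex_on UNIV (potential \<phi>)"
  unfolding convex_on_def
proof (intro conjI ballI allI impI convex_UNIV)
  fix x y :: 'a and u v :: real
  assume uv: "0 \<le> u" "0 \<le> v" "u + v = 1"
  define r where "r = norm (u *\<^sub>R x + v *\<^sub>R y)"
  have "r \<le> u * norm x + v * norm y"
    unfolding r_def using norm_triangle_ineq[of "u *\<^sub>R x" "v *\<^sub>R y"] uv by simp
  then have "0 \<le> \<phi> r * (u * norm x + v * norm y - r)"
    by (intro mult_nonneg_nonneg phi_nonneg) (auto simp: r_def)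
  then have "G r \<le> (u + v) * G r + \<phi> r * (u * norm x + v * norm y - (u + v) * r)"
    using uv by simp
  also have "\<dots> = u * (G r + \<phi> r * (norm x - r)) + v * (G r + \<phi> r * (norm y - r))"
    by (simp add: algebra_simps)
  also have "\<dots> \<le> u * G (norm x) + v * G (norm y)"
    by (intro add_mono mult_left_mono G_subgradient uv) (auto simp: r_def)
  finally show "potential \<phi> (u *\<^sub>R x + v *\<^sub>R y) \<le> u * potential \<phi> x + v * potential \<phi> y"
    by (simp add: potential_G r_def)
qed

lemma fenchel_young: "blinfun_apply y x \<le> potential \<phi> x + conjugate (potential \<phi>) y"
  using cSUP_upper[OF UNIV_I bdd_above_conjugate_potential[OF gauge], of y x]
  by (simp add: conjugate_def)

lemma conjugate_le: "(\<And>x. blinfun_apply y x - \<Psi> x \<le> c) \<Longrightarrow> conjugate \<Psi> y \<le> c"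
  unfolding conjugate_def by (rule cSUP_least) auto

lemma conjugate_nonneg: "conjugate (potential \<phi>) (y :: 'a::real_normed_vector dual) \<ge> 0"
  using fenchel_young[of y 0] by (simp add: potential_zero)

lemma conjugate_convex:
  "convex_on UNIV (conjugate (potential \<phi> :: 'a::real_normed_vector \<Rightarrow> real))"
  unfolding convex_on_def
proof (intro conjI ballI allI impI convex_UNIV)
  fix y z :: "'a dual" and u v :: real
  assume uv: "0 \<le> u" "0 \<le> v" "u + v = 1"
  let ?C = "conjugate (potential \<phi> :: 'a \<Rightarrow> real)"
  show "?C (u *\<^sub>R y + v *\<^sub>R z) \<le> u * ?C y + v * ?C z"
  proof (rule conjugate_le)
    fix x :: 'a
    have "u * blinfun_apply y x + v * blinfun_apply z x \<le>
        u * (potential \<phi> x + ?C y) + v * (potential \<phi> x + ?C z)"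
      by (intro add_mono mult_left_mono fenchel_young uv)
    also have "\<dots> = (u + v) * potential \<phi> x + (u * ?C y + v * ?C z)" by (simp add: algebra_simps)
    finally show "blinfun_apply (u *\<^sub>R y + v *\<^sub>R z) x - potential \<phi> x \<le> u * ?C y + v * ?C z"
      using uv by (simp add: blinfun.add_left blinfun.scaleR_left)
  qed
qed

lemma duality_map_subgradient:
  assumes "w \<in> duality_map \<phi> z"
  shows "potential \<phi> z + blinfun_apply w (x - z) \<le> potential \<phi> x"
proof -
  have w: "blinfun_apply w z = norm z * \<phi> (norm z)" "norm w = \<phi> (norm z)"
    using assms by (auto simp: duality_map_def)
  have "G (norm z) + \<phi> (norm z) * (norm x - norm z) \<le> G (norm x)"
    by (intro G_subgradient) auto
  moreover have "blinfun_apply w x \<le> \<phi> (norm z) * norm x"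
    using blinfun_apply_le[of w x] w by simp
  ultimately show ?thesis
    by (simp add: potential_G blinfun.diff_right w algebra_simps)
qed

text \<open>A subgradient at \<open>z\<close> maximizes \<open>r \<mapsto> r * norm w - G r\<close> at \<open>norm z\<close>;
  comparing with \<open>r\<close> on either side of \<open>norm z\<close> gives \<open>norm w = \<phi> (norm z)\<close>.\<close>

lemma duality_map_iff_subgradient:
  "w \<in> duality_map \<phi> z \<longleftrightarrow> (\<forall>x. potential \<phi> z + blinfun_apply w (x - z) \<le> potential \<phi> x)"
proof (intro iffI allI duality_map_subgradient)
  assume sub: "\<forall>x. potential \<phi> z + blinfun_apply w (x - z) \<le> potential \<phi> x"
  define c where "c = blinfun_apply w z - G (norm z)"
  have c: "blinfun_apply w x \<le> c + G (norm x)" for x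
    using sub[rule_format, of x] by (simp add: c_def potential_G blinfun.diff_right)
  have "c \<ge> 0" using c[of 0] by (simp add: G_zero)
  have le: "r * norm w \<le> c + G r" if r: "r \<ge> 0" for r
  proof (cases "r = 0")
    case False
    have "norm w \<le> (c + G r) / r"
    proof (rule dual_norm_le)
      fix x :: 'a assume x: "norm x \<le> 1"
      show "blinfun_apply w x \<le> (c + G r) / r"
      proof (cases "x = 0")
        case True
        then show ?thesis using \<open>c \<ge> 0\<close> G_nonneg[OF r] r by simp
      next
        case nz: False
        have "blinfun_apply w ((r / norm x) *\<^sub>R x) \<le> c + G r"
          using c[of "(r / norm x) *\<^sub>R x"] nz r by simp
        then have "blinfun_apply w x \<le> norm x * ((c + G r) / r)"
          using nz r False by (simp add: blinfun.scaleR_right field_simps)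
        also have "\<dots> \<le> 1 * ((c + G r) / r)"
          using x \<open>c \<ge> 0\<close> G_nonneg[OF r] r by (intro mult_right_mono) auto
        finally show ?thesis by simp
      qed
    qed
    then show ?thesis using False r by (simp add: field_simps)
  qed (use \<open>c \<ge> 0\<close> in \<open>auto simp: G_zero\<close>)
  define r0 where "r0 = norm z"
  have attained: "blinfun_apply w z = r0 * norm w"
    using le[of r0] blinfun_apply_le[of w z] by (simp add: c_def r0_def mult.commute)
  have slope: "(r - r0) * norm w \<le> G r - G r0" if "r \<ge> 0" for r
    using le[OF that] attained by (simp add: c_def r0_def algebra_simps)
  have "norm w \<le> \<phi> r0"
  proof (rule tendsto_lowerbound)
    show "((\<lambda>r. \<phi> r) \<longlongrightarrow> \<phi> r0) (at_right r0)"
    proof (rule phi_tendsto)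
      show "\<forall>\<^sub>F r in at_right r0. r \<ge> 0"
        using eventually_at_right_less[of r0]
        by (rule eventually_mono) (use norm_ge_zero[of z] in \<open>unfold r0_def, linarith\<close>)
    qed (auto simp: r0_def)
    show "\<forall>\<^sub>F r in at_right r0. norm w \<le> \<phi> r"
      using eventually_at_right_less[of r0]
    proof eventually_elim
      case (elim r)
      have "0 \<le> r0" by (simp add: r0_def)
      then have "(r - r0) * norm w \<le> (r - r0) * \<phi> r"
        using slope[of r] G_subgradient[of r r0] elim by (simp add: algebra_simps)
      then show ?case using elim by simp
    qed
  qed simp
  moreover have "norm w \<ge> \<phi> r0"
  proof (cases "r0 = 0")
    case False
    then have pos: "r0 > 0" by (simp add: r0_def)
    have ev: "\<forall>\<^sub>F r in at_left r0. 0 < r \<and> r < r0"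
      using eventually_at_left_real[OF pos] by simp
    show ?thesis
    proof (rule tendsto_upperbound)
      show "((\<lambda>r. \<phi> r) \<longlongrightarrow> \<phi> r0) (at_left r0)"
        by (rule phi_tendsto) (use ev pos in \<open>auto elim: eventually_mono\<close>)
      show "\<forall>\<^sub>F r in at_left r0. \<phi> r \<le> norm w"
        using ev
      proof eventually_elim
        case (elim r)
        then have "(r0 - r) * \<phi> r \<le> (r0 - r) * norm w"
          using slope[of r] G_subgradient[of r r0] pos by (simp add: algebra_simps)
        then show ?case using elim by simp
      qed
    qed simp
  qed (simp add: phi_zero)
  ultimately have "norm w = \<phi> r0" by simp
  then show "w \<in> duality_map \<phi> z" using attained by (simp add: duality_map_def r0_def)
qed

text \<open>This is the equality case of the Fenchel-Young inequality. Written with \<le>, it is a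
  condition that the limit argument below can deliver.\<close>

lemma duality_map_iff_fenchel:
  "w \<in> duality_map \<phi> z \<longleftrightarrow> potential \<phi> z + conjugate (potential \<phi>) w \<le> blinfun_apply w z"
proof
  assume w: "w \<in> duality_map \<phi> z"
  have "conjugate (potential \<phi>) w \<le> blinfun_apply w z - potential \<phi> z"
    using duality_map_subgradient[OF w] by (intro conjugate_le) (simp add: blinfun.diff_right algebra_simps)
  then show "potential \<phi> z + conjugate (potential \<phi>) w \<le> blinfun_apply w z" by simp
next
  assume le: "potential \<phi> z + conjugate (potential \<phi>) w \<le> blinfun_apply w z"
  show "w \<in> duality_map \<phi> z"
    unfolding duality_map_iff_subgradient
  proof
    fix x
    show "potential \<phi> z + blinfun_apply w (x - z) \<le> potential \<phi> x"
      using le fenchel_young[of w x] by (simp add: blinfun.diff_right)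
  qed
qed

text \<open>Off 0 the chain rule applies. At 0 the norm has no derivative to compose with, but the
  quotient of the potential is at most \<open>\<phi> (\<bar>t\<bar> * norm h) * norm h\<close>,
  which vanishes in the limit because \<open>\<phi> 0 = 0\<close>.\<close>

lemma gateaux_derivs_potential_nonempty:
  assumes smooth: "gateaux_smooth TYPE('a::real_normed_vector)"
  shows "gateaux_derivs (potential \<phi>) (z :: 'a) \<noteq> {}"
proof (cases "z = 0")
  case True
  have "((\<lambda>t. potential \<phi> (t *\<^sub>R h) / t) \<longlongrightarrow> 0) (at 0)" for h :: 'a
  proof (rule Lim_null_comparison)
    have "((\<lambda>t. \<phi> (\<bar>t\<bar> * norm h) * norm h) \<longlongrightarrow> \<phi> 0 * norm h) (at 0)"
      by (intro tendsto_mult phi_tendsto tendsto_const) (auto intro!: tendsto_eq_intros)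
    then show "((\<lambda>t. \<phi> (\<bar>t\<bar> * norm h) * norm h) \<longlongrightarrow> 0) (at 0)" by (simp add: phi_zero)
    have "norm (potential \<phi> (t *\<^sub>R h) / t) \<le> \<phi> (\<bar>t\<bar> * norm h) * norm h" if "t \<noteq> 0" for t
    proof -
      have "G (\<bar>t\<bar> * norm h) \<le> \<phi> (\<bar>t\<bar> * norm h) * (\<bar>t\<bar> * norm h)"
        using G_subgradient[of "\<bar>t\<bar> * norm h" 0] by (simp add: G_zero)
      moreover have "G (\<bar>t\<bar> * norm h) \<ge> 0" by (simp add: G_nonneg)
      ultimately show ?thesis using that by (simp add: potential_G field_simps)
    qed
    then show "\<forall>\<^sub>F t in at 0. norm (potential \<phi> (t *\<^sub>R h) / t) \<le> \<phi> (\<bar>t\<bar> * norm h) * norm h"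
      by (auto simp: eventually_at intro!: exI[of _ 1])
  qed
  then have "0 \<in> gateaux_derivs (potential \<phi>) z"
    by (simp add: gateaux_derivs_def True potential_zero)
  then show ?thesis by blast
next
  case False
  then obtain N where N: "N \<in> gateaux_derivs norm z"
    using smooth by (auto simp: gateaux_smooth_def)
  have "((\<lambda>t. potential \<phi> (z + t *\<^sub>R h)) has_real_derivative \<phi> (norm z) * blinfun_apply N h) (at 0)" for h
    unfolding potential_G
    by (rule DERIV_chain2) (use N False G_deriv in \<open>auto simp: gateaux_derivs_DERIV\<close>)
  then have "\<phi> (norm z) *\<^sub>R N \<in> gateaux_derivs (potential \<phi>) z"
    by (simp add: gateaux_derivs_DERIV blinfun.scaleR_left)
  then show ?thesis by blast
qed

lemma smooth_duality_map:
  assumes smooth: "gateaux_smooth TYPE('a::real_normed_vector)"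
  obtains j :: "'a::real_normed_vector \<Rightarrow> 'a dual" where "\<And>z. duality_map \<phi> z = {j z}"
    "\<And>z. gateaux_derivs (potential \<phi>) z = {j z}"
proof -
  define j :: "'a \<Rightarrow> 'a dual" where "j z = (SOME D. D \<in> gateaux_derivs (potential \<phi>) z)" for z
  have j: "j z \<in> gateaux_derivs (potential \<phi>) z" for z
    using gateaux_derivs_potential_nonempty[OF smooth, of z] unfolding j_def some_in_eq .
  have "duality_map \<phi> z = {j z}" for z
    using subgradient_eq_gateaux_deriv[OF j[of z]] gateaux_deriv_subgradient[OF potential_convex j[of z]]
    by (auto simp: duality_map_iff_subgradient)
  moreover have "gateaux_derivs (potential \<phi>) z = {j z}" for z
    using j[of z] gateaux_derivs_unique by blast
  ultimately show ?thesis using that by blast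
qed

end

section \<open>Surjectivity of the sum of a maximally monotone operator and the duality map\<close>

text \<open>Here \<open>D p q\<close> stands for the pairing of b at p with a at q, and the
  hypothesis is monotonicity. Averaging it with weights \<open>l p * l q\<close> counts either side
  of the claim twice, by symmetry.\<close>

lemma monotone_convex_combination:
  fixes D :: "'i \<Rightarrow> 'i \<Rightarrow> real"
  assumes l: "\<And>p. p \<in> S \<Longrightarrow> l p \<ge> 0" "sum l S = 1"
    and D: "\<And>p q. p \<in> S \<Longrightarrow> q \<in> S \<Longrightarrow> 0 \<le> D p p - D p q - D q p + D q q"
  shows "(\<Sum>p\<in>S. \<Sum>q\<in>S. l p * l q * D p q) \<le> (\<Sum>p\<in>S. l p * D p p)"
proof -
  have "0 \<le> (\<Sum>p\<in>S. \<Sum>q\<in>S. l p * l q * (D p p - D p q - D q p + D q q))"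
    by (intro sum_nonneg mult_nonneg_nonneg l D)
  also have "\<dots> = (\<Sum>p\<in>S. \<Sum>q\<in>S. l p * l q * D p p) - (\<Sum>p\<in>S. \<Sum>q\<in>S. l p * l q * D p q)
      - (\<Sum>p\<in>S. \<Sum>q\<in>S. l p * l q * D q p) + (\<Sum>p\<in>S. \<Sum>q\<in>S. l p * l q * D q q)"
    by (simp add: algebra_simps sum.distrib sum_subtractf)
  also have "(\<Sum>p\<in>S. \<Sum>q\<in>S. l p * l q * D q p) = (\<Sum>p\<in>S. \<Sum>q\<in>S. l p * l q * D p q)"
    by (subst sum.swap) (simp add: mult.commute)
  also have "(\<Sum>p\<in>S. \<Sum>q\<in>S. l p * l q * D p p) = (\<Sum>p\<in>S. l p * D p p)"
  proof (rule sum.cong[OF refl])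
    fix p
    have "(\<Sum>q\<in>S. l p * l q * D p p) = l p * D p p * sum l S"
      by (simp add: sum_distrib_left mult_ac)
    then show "(\<Sum>q\<in>S. l p * l q * D p p) = l p * D p p" using l by simp
  qed
  also have "(\<Sum>p\<in>S. \<Sum>q\<in>S. l p * l q * D q q) = (\<Sum>q\<in>S. l q * D q q)"
  proof (subst sum.swap, rule sum.cong[OF refl])
    fix q
    have "(\<Sum>p\<in>S. l p * l q * D q q) = l q * D q q * sum l S"
      by (simp add: sum_distrib_left mult_ac)
    then show "(\<Sum>p\<in>S. l p * l q * D q q) = l q * D q q" using l by simp
  qed
  finally show ?thesis by simp
qed

lemma maximally_monotone_mem:
  assumes T: "maximally_monotone T"
    and related: "\<And>a b. b \<in> T a \<Longrightarrow> 0 \<le> blinfun_apply (b - v) (a - z)"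
  shows "v \<in> T z"
proof (rule ccontr)
  assume v: "v \<notin> T z"
  define S where "S = T(z := insert v (T z))"
  have S: "b \<in> S a \<longleftrightarrow> b \<in> T a \<or> (a = z \<and> b = v)" for a b
    by (auto simp: S_def)
  have swap: "blinfun_apply (v - b) (z - a) = blinfun_apply (b - v) (a - z)" for a b
    by (simp add: blinfun.diff_left blinfun.diff_right)
  have "monotone_operator S"
    using T related swap unfolding monotone_operator_def maximally_monotone_def Ball_def S
    by (metis blinfun.zero_right diff_self order_refl)
  moreover have "Sigma UNIV T \<subset> Sigma UNIV S"
    using v S by blast
  ultimately show False using T by (auto simp: maximally_monotone_def)
qed

text \<open>The standing assumption is that the duality map is a function j. That j is the
  derivative of the potential is passed separately to the lemmas that use it.\<close>

locale smooth_duality = gauge_potential \<phi> for \<phi> +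
  fixes j :: "'a::real_normed_vector \<Rightarrow> 'a dual"
  assumes duality_map_eq: "duality_map \<phi> z = {j z}"
begin

abbreviation \<Psi> :: "'a \<Rightarrow> real" where "\<Psi> \<equiv> potential \<phi>"
abbreviation \<Psi>c :: "'a dual \<Rightarrow> real" where "\<Psi>c \<equiv> conjugate \<Psi>"

lemma norm_j: "norm (j z) = \<phi> (norm z)"
  and j_self: "blinfun_apply (j z) z = norm z * \<phi> (norm z)"
proof -
  have "j z \<in> duality_map \<phi> z" by (simp add: duality_map_eq)
  then show "norm (j z) = \<phi> (norm z)" "blinfun_apply (j z) z = norm z * \<phi> (norm z)"
    by (auto simp: duality_map_def)
qed

lemma j_le: "blinfun_apply (j z) x \<le> \<phi> (norm z) * norm x"
  using blinfun_apply_le[of "j z" x] by (simp add: norm_j)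

lemma j_fenchel: "\<Psi> z + \<Psi>c (j z) \<le> blinfun_apply (j z) z"
  using duality_map_iff_fenchel[of "j z" z] by (simp add: duality_map_eq)

lemma eq_j_if_fenchel: "\<Psi> z + \<Psi>c w \<le> blinfun_apply w z \<Longrightarrow> w = j z"
  using duality_map_iff_fenchel[of w z] by (simp add: duality_map_eq)

text \<open>The functional \<open>j x\<close> attains its norm in the direction of x, so it serves
  as the norming functional of x.\<close>

lemma norm_le_bidual_embed: "norm (x :: 'a) \<le> norm (bidual_embed x)"
proof (cases "x = 0")
  case False
  then have "norm (j x) > 0" using phi_less[of 0 "norm x"] by (simp add: norm_j phi_zero)
  moreover have "norm x * norm (j x) \<le> norm (bidual_embed x) * norm (j x)"
    using blinfun_apply_le[of "bidual_embed x" "j x"] by (simp add: j_self norm_j)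
  ultimately show ?thesis by simp
qed simp

text \<open>Up to the duality pairing of \<open>z\<close> and \<open>w\<close>, which cancels, the value at \<open>(a, b)\<close> and
  \<open>(z, w)\<close> is the defect in the Fenchel--Young inequality for \<open>(z, w)\<close> minus the pairing of
  \<open>a - z\<close> with \<open>b + w\<close>. It is jointly convex in \<open>(z, w)\<close>.\<close>

definition gap :: "'a \<times> 'a dual \<Rightarrow> 'a \<times> 'a dual \<Rightarrow> real"
  where "gap p q = \<Psi> (fst q) + \<Psi>c (snd q)
    - blinfun_apply (snd q) (fst p) + blinfun_apply (snd p) (fst q) - blinfun_apply (snd p) (fst p)"

lemma gap_convex: "convex_on UNIV (\<lambda>q. gap p q - c)"
proof (rule convex_onI)
  fix t :: real and q q' :: "'a \<times> 'a dual"
  assume t: "0 < t" "t < 1"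
  have "\<Psi> ((1 - t) *\<^sub>R fst q + t *\<^sub>R fst q') \<le> (1 - t) * \<Psi> (fst q) + t * \<Psi> (fst q')"
    using t by (intro convex_onD[OF potential_convex]) auto
  moreover have "\<Psi>c ((1 - t) *\<^sub>R snd q + t *\<^sub>R snd q') \<le> (1 - t) * \<Psi>c (snd q) + t * \<Psi>c (snd q')"
    using t by (intro convex_onD[OF conjugate_convex]) auto
  \<comment> \<open>Apart from the two convex terms the gap is affine in q, so the rest interpolates
    exactly.\<close>
  moreover have "gap p ((1 - t) *\<^sub>R q + t *\<^sub>R q') - c =
      \<Psi> ((1 - t) *\<^sub>R fst q + t *\<^sub>R fst q') + \<Psi>c ((1 - t) *\<^sub>R snd q + t *\<^sub>R snd q')
      + (1 - t) * (gap p q - c - \<Psi> (fst q) - \<Psi>c (snd q))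
      + t * (gap p q' - c - \<Psi> (fst q') - \<Psi>c (snd q'))"
    unfolding gap_def fst_add snd_add fst_scaleR snd_scaleR blinfun.add_right blinfun.scaleR_right
      blinfun.add_left blinfun.scaleR_left
    by (simp add: algebra_simps)
  ultimately show "gap p ((1 - t) *\<^sub>R q + t *\<^sub>R q') - c \<le> (1 - t) * (gap p q - c) + t * (gap p q' - c)"
    by (simp add: algebra_simps)
qed simp

text \<open>Averaged over the points \<open>(a, b)\<close> with weights \<open>l\<close>, the gap at \<open>z = (\<Sum>p\<in>S. l p *\<^sub>R a p)\<close>
  and \<open>w = j z\<close> is nonpositive by monotonicity.\<close>

lemma gap_finite:
  assumes S: "finite S" "S \<noteq> {}"
    and mono: "\<And>p q. p \<in> S \<Longrightarrow> q \<in> S \<Longrightarrow> 0 \<le> blinfun_apply (snd p - snd q) (fst p - fst q)"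
    and "\<epsilon> > 0"
  shows "\<exists>q. \<forall>p\<in>S. gap p q \<le> \<epsilon>"
proof (rule ccontr)
  assume "\<not> ?thesis"
  \<comment> \<open>The slack makes the contradiction strict: the averaged gap at
    \<open>(z, j z)\<close> is nonpositive, while the alternative makes it at least
    \<open>\<epsilon>\<close>.\<close>
  then have alt: "\<exists>p\<in>S. gap p q - \<epsilon> \<ge> 0" for q
    unfolding diff_ge_0_iff_ge by (meson linear)
  obtain l where l: "\<And>p. p \<in> S \<Longrightarrow> l p \<ge> 0" "sum l S = 1"
    "\<And>q. (\<Sum>p\<in>S. l p * (gap p q - \<epsilon>)) \<ge> 0"
    using convex_alternative[OF S convex_UNIV gap_convex alt] by auto
  define z where "z = (\<Sum>p\<in>S. l p *\<^sub>R fst p)"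
  have "(\<Sum>p\<in>S. l p * gap p (z, j z)) = (\<Psi> z + \<Psi>c (j z)) * sum l S
      - (\<Sum>p\<in>S. l p * blinfun_apply (j z) (fst p)) + (\<Sum>p\<in>S. l p * blinfun_apply (snd p) z)
      - (\<Sum>p\<in>S. l p * blinfun_apply (snd p) (fst p))"
    by (simp add: gap_def algebra_simps sum.distrib sum_subtractf sum_distrib_left sum_distrib_right)
  also have "(\<Sum>p\<in>S. l p * blinfun_apply (j z) (fst p)) = blinfun_apply (j z) z"
    by (simp add: z_def blinfun.sum_right blinfun.scaleR_right)
  also have "(\<Sum>p\<in>S. l p * blinfun_apply (snd p) z) =
      (\<Sum>p\<in>S. \<Sum>q\<in>S. l p * l q * blinfun_apply (snd p) (fst q))"
    by (simp add: z_def blinfun.sum_right blinfun.scaleR_right sum_distrib_left mult_ac)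
  also have "\<dots> \<le> (\<Sum>p\<in>S. l p * blinfun_apply (snd p) (fst p))"
    by (rule monotone_convex_combination[OF l(1,2)])
      (use mono in \<open>auto simp: blinfun.diff_left blinfun.diff_right algebra_simps\<close>)
  finally have "(\<Sum>p\<in>S. l p * gap p (z, j z)) \<le> 0"
    using j_fenchel[of z] l(2) by simp
  moreover have "(\<Sum>p\<in>S. l p * (gap p (z, j z) - \<epsilon>)) = (\<Sum>p\<in>S. l p * gap p (z, j z)) - \<epsilon> * sum l S"
    by (simp add: algebra_simps sum_subtractf sum_distrib_left)
  ultimately show False using l(2) l(3)[of "(z, j z)"] \<open>\<epsilon> > 0\<close> by simp
qed

text \<open>At the base point the pairing with w drops out. The superlinear growth of the potential
  then absorbs the pairing of b with z and bounds z; what remains bounds \<open>\<Psi>c w\<close>,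
  and Fenchel-Young on the unit ball turns this into a bound for w. The slope
  \<open>norm b + 1\<close> leaves one copy of \<open>norm z\<close> over.\<close>

lemma gap_bounded:
  obtains R R' where "\<And>q. gap (0, b) q \<le> 1 \<Longrightarrow> norm (fst q) \<le> R \<and> norm (snd q) \<le> R'"
proof -
  obtain K where K: "\<And>r. r \<ge> 0 \<Longrightarrow> (norm b + 1) * r \<le> G r + K" using G_coercive by blast
  have "norm (fst q) \<le> 1 + K \<and> norm (snd q) \<le> G 1 + 1 + norm b * (1 + K)" if "gap (0, b) q \<le> 1" for q
  proof -
    have le: "\<Psi> (fst q) + \<Psi>c (snd q) + blinfun_apply b (fst q) \<le> 1"
      using that by (simp add: gap_def)
    have b: "- blinfun_apply b (fst q) \<le> norm b * norm (fst q)"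
      using norm_blinfun[of b "fst q"] by simp
    have "G (norm (fst q)) \<le> 1 + norm b * norm (fst q)"
      using le b conjugate_nonneg[of "snd q"] by (simp add: potential_G)
    then have fst: "norm (fst q) \<le> 1 + K" using K[of "norm (fst q)"] by (simp add: algebra_simps)
    then have "norm b * norm (fst q) \<le> norm b * (1 + K)" by (intro mult_left_mono) auto
    then have \<Psi>c: "\<Psi>c (snd q) \<le> 1 + norm b * (1 + K)"
      using le b potential_nonneg[of "fst q"] by linarith
    have "norm (snd q) \<le> G 1 + 1 + norm b * (1 + K)"
    proof (rule dual_norm_le)
      fix x :: 'a assume "norm x \<le> 1"
      then have "\<Psi> x \<le> G 1" by (simp add: potential_G G_mono)
      then show "blinfun_apply (snd q) x \<le> G 1 + 1 + norm b * (1 + K)"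
        using fenchel_young[of "snd q" x] \<Psi>c by linarith
    qed
    with fst show ?thesis by blast
  qed
  with that show ?thesis by blast
qed

text \<open>Approximate solutions for finitely many conditions are bounded, so z clusters weakly by
  reflexivity and, along a finer filter, w clusters pointwise. The gap is lower semicontinuous for
  this convergence, being a supremum of functions that are affine and continuous in z and w
  separately.\<close>

lemma gap_exists:
  assumes refl: "surj (bidual_embed :: 'a \<Rightarrow> _)"
    and mono: "\<And>p q. p \<in> A \<Longrightarrow> q \<in> A \<Longrightarrow> 0 \<le> blinfun_apply (snd p - snd q) (fst p - fst q)"
    and base: "(0, b) \<in> A"
  shows "\<exists>q. \<forall>p\<in>A. gap p q \<le> 0"
proof -
  \<comment> \<open>The second component prescribes the tolerance \<open>1 / Suc n\<close>, so that
    larger finite sets impose more conditions and also sharper ones.\<close>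
  define B where "B = A \<times> (UNIV :: nat set)"
  have "\<exists>q. gap (0, b) q \<le> 1 \<and> (\<forall>(p, n)\<in>S. gap p q \<le> 1 / Suc n)" if S: "finite S" "S \<subseteq> B" for S
  proof -
    obtain N where N: "\<And>n. n \<in> snd ` S \<Longrightarrow> n \<le> N"
      using S(1) by (meson finite_imageI finite_nat_set_iff_bounded_le)
    have "\<exists>q. \<forall>p\<in>insert (0, b) (fst ` S). gap p q \<le> 1 / Suc N"
    proof (rule gap_finite)
      have "insert (0, b) (fst ` S) \<subseteq> A" using S(2) base by (auto simp: B_def)
      then show "0 \<le> blinfun_apply (snd p - snd q) (fst p - fst q)"
        if "p \<in> insert (0, b) (fst ` S)" "q \<in> insert (0, b) (fst ` S)" for p q
        using that by (intro mono) auto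
    qed (use S(1) in auto)
    then obtain q where q: "\<And>p. p \<in> insert (0, b) (fst ` S) \<Longrightarrow> gap p q \<le> 1 / Suc N"
      by blast
    have "gap p q \<le> 1 / Suc n" if "(p, n) \<in> S" for p n
    proof -
      have "n \<in> snd ` S" "p \<in> fst ` S" using that by force+
      then have "gap p q \<le> 1 / Suc N" "n \<le> N" using q[of p] N by auto
      moreover have "1 / real (Suc N) \<le> 1 / Suc n" using \<open>n \<le> N\<close> by (simp add: frac_le)
      ultimately show ?thesis by linarith
    qed
    moreover have "gap (0, b) q \<le> 1"
    proof -
      have "1 / real (Suc N) \<le> 1" by simp
      then show ?thesis using q[of "(0, b)"] by (meson insertI1 order_trans)
    qed
    ultimately show ?thesis by blast
  qed
  then have "\<forall>S. \<exists>q. finite S \<and> S \<subseteq> B \<longrightarrow> gap (0, b) q \<le> 1 \<and> (\<forall>(p, n)\<in>S. gap p q \<le> 1 / Suc n)"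
    by blast
  from choice[OF this] obtain Q where
    "\<forall>S. finite S \<and> S \<subseteq> B \<longrightarrow> gap (0, b) (Q S) \<le> 1 \<and> (\<forall>(p, n)\<in>S. gap p (Q S) \<le> 1 / Suc n)"
    by blast
  then have Q: "\<And>S. finite S \<Longrightarrow> S \<subseteq> B \<Longrightarrow> gap (0, b) (Q S) \<le> 1"
    "\<And>S p n. finite S \<Longrightarrow> S \<subseteq> B \<Longrightarrow> (p, n) \<in> S \<Longrightarrow> gap p (Q S) \<le> 1 / Suc n"
    by blast+
  define F where "F = finite_subsets_at_top B"
  obtain R R' where R: "\<And>q. gap (0, b) q \<le> 1 \<Longrightarrow> norm (fst q) \<le> R \<and> norm (snd q) \<le> R'"
    using gap_bounded by blast
  have "\<forall>\<^sub>F S in F. norm (fst (Q S)) \<le> R \<and> norm (snd (Q S)) \<le> R'"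
    unfolding F_def by (rule eventually_finite_subsets_at_top_weakI) (use R Q(1) in blast)
  then have bnd: "\<forall>\<^sub>F S in F. norm (fst (Q S)) \<le> R" "\<forall>\<^sub>F S in F. norm (snd (Q S)) \<le> R'"
    by (auto elim: eventually_mono)
  obtain U z where U: "U \<le> F" "U \<noteq> bot"
    "\<And>y :: 'a dual. ((\<lambda>S. blinfun_apply y (fst (Q S))) \<longlongrightarrow> blinfun_apply y z) U"
    using reflexive_weak_cluster[OF refl _ bnd(1)] by (auto simp: F_def)
  obtain V w where V: "V \<le> U" "V \<noteq> bot"
    "\<And>x. ((\<lambda>S. blinfun_apply (snd (Q S)) x) \<longlongrightarrow> blinfun_apply w x) V"
    using banach_alaoglu_cluster[OF U(2) filter_leD[OF U(1) bnd(2)]] by blast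
  have limz: "((\<lambda>S. blinfun_apply y (fst (Q S))) \<longlongrightarrow> blinfun_apply y z) V" for y :: "'a dual"
    using U(3) V(1) tendsto_mono by blast
  have "gap p (z, w) \<le> 0" if p: "p \<in> A" for p
  proof (rule field_le_epsilon)
    fix e :: real assume "e > 0"
    then obtain n where n: "1 / real (Suc n) < e" using nat_approx_posE by blast
    have "\<Psi>c w \<le> e - \<Psi> z + blinfun_apply w (fst p) - blinfun_apply (snd p) z
        + blinfun_apply (snd p) (fst p)"
    proof (rule conjugate_le)
      fix x :: 'a
      \<comment> \<open>The potential is replaced by its affine minorant of slope
        \<open>j z\<close>, which is exact at the limit z, and the conjugate by its minorant at x.
        All terms of H converge, and the supremum over x recovers \<open>\<Psi>c w\<close>.\<close>
      define H where "H S = blinfun_apply (j z) (fst (Q S)) - \<Psi>c (j z)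
        + blinfun_apply (snd (Q S)) x - \<Psi> x - blinfun_apply (snd (Q S)) (fst p)
        + blinfun_apply (snd p) (fst (Q S)) - blinfun_apply (snd p) (fst p)" for S
      have "\<forall>\<^sub>F S in F. H S \<le> 1 / Suc n"
        unfolding F_def eventually_finite_subsets_at_top
      proof (intro exI[of _ "{(p, n)}"] conjI allI impI)
        show "{(p, n)} \<subseteq> B" using p by (simp add: B_def)
        fix S assume "finite S \<and> {(p, n)} \<subseteq> S \<and> S \<subseteq> B"
        then have "gap p (Q S) \<le> 1 / Suc n" using Q(2) by auto
        then show "H S \<le> 1 / Suc n"
          using fenchel_young[of "j z" "fst (Q S)"] fenchel_young[of "snd (Q S)" x]
          unfolding H_def gap_def by linarith
      qed simp
      then have "\<forall>\<^sub>F S in V. H S \<le> 1 / Suc n"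
        using V(1) U(1) by (meson filter_leD)
      moreover have "(H \<longlongrightarrow> blinfun_apply (j z) z - \<Psi>c (j z) + blinfun_apply w x - \<Psi> x
          - blinfun_apply w (fst p) + blinfun_apply (snd p) z - blinfun_apply (snd p) (fst p)) V"
        unfolding H_def by (intro tendsto_intros limz V(3))
      ultimately have "blinfun_apply (j z) z - \<Psi>c (j z) + blinfun_apply w x - \<Psi> x
          - blinfun_apply w (fst p) + blinfun_apply (snd p) z - blinfun_apply (snd p) (fst p) \<le> 1 / Suc n"
        using V(2) by (intro tendsto_upperbound)
      then show "blinfun_apply w x - \<Psi> x \<le> e - \<Psi> z + blinfun_apply w (fst p)
          - blinfun_apply (snd p) z + blinfun_apply (snd p) (fst p)"
        using j_fenchel[of z] n by linarith
    qed
    then show "gap p (z, w) \<le> 0 + e" by (simp add: gap_def)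
  qed
  then show ?thesis by blast
qed

text \<open>For the constant operator with value \<open>- y\<close>, the gap inequalities bound the
  functional \<open>w - y\<close> below on the whole space. Hence it is 0, and the inequality at a =
  0 is the equality case of Fenchel-Young.\<close>

lemma j_surj:
  assumes refl: "surj (bidual_embed :: 'a \<Rightarrow> _)"
  shows "\<exists>z. j z = y"
proof -
  have "\<exists>q. \<forall>p\<in>UNIV \<times> {- y}. gap p q \<le> 0"
    by (rule gap_exists[OF refl, of _ "- y"]) auto
  then obtain q where q: "\<And>p. p \<in> UNIV \<times> {- y} \<Longrightarrow> gap p q \<le> 0"
    by blast
  obtain z w where zw: "q = (z, w)" by force
  have le: "\<Psi> z + \<Psi>c w - blinfun_apply y z \<le> blinfun_apply (w - y) a" for a
    using q[of "(a, - y)"] by (simp add: zw gap_def blinfun.diff_left blinfun.minus_left)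
  define c where "c = \<bar>\<Psi> z + \<Psi>c w - blinfun_apply y z\<bar>"
  have "blinfun_apply (w - y) a = 0" for a
  proof (rule ccontr)
    assume nz: "blinfun_apply (w - y) a \<noteq> 0"
    show False
      using le[of "(- (c + 1) / blinfun_apply (w - y) a) *\<^sub>R a"] nz
      by (simp add: blinfun.scaleR_right c_def)
  qed
  then have "w = y" by (metis blinfun_eqI eq_iff_diff_eq_0 zero_blinfun.rep_eq)
  moreover from le[of 0] have "\<Psi> z + \<Psi>c w \<le> blinfun_apply y z" by simp
  ultimately show ?thesis using eq_j_if_fenchel[of z w] by auto
qed

lemma resolvent_exists:
  assumes refl: "surj (bidual_embed :: 'a \<Rightarrow> _)"
    and T: "maximally_monotone T" and T0: "T 0 \<noteq> {}"
  shows "\<exists>z. y - j z \<in> T z"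
proof -
  define A where "A = {(a, b - y) | a b. b \<in> T a}"
  have mono: "0 \<le> blinfun_apply (b - b') (a - a')" if "b \<in> T a" "b' \<in> T a'" for a b a' b'
    using T that by (auto simp: maximally_monotone_def monotone_operator_def)
  obtain b0 where b0: "b0 \<in> T 0" using T0 by blast
  have "\<exists>q. \<forall>p\<in>A. gap p q \<le> 0"
    by (rule gap_exists[OF refl, of _ "b0 - y"]) (use mono b0 in \<open>auto simp: A_def\<close>)
  then obtain z w where zw: "\<And>p. p \<in> A \<Longrightarrow> gap p (z, w) \<le> 0" by auto
  have gap: "\<Psi> z + \<Psi>c w - blinfun_apply w z \<le> blinfun_apply (b - (y - w)) (a - z)" if "b \<in> T a" for a b
    using zw[of "(a, b - y)"] that
    by (auto simp: A_def gap_def blinfun.diff_left blinfun.diff_right blinfun.add_left algebra_simps)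
  have "y - w \<in> T z"
  proof (rule maximally_monotone_mem[OF T])
    show "0 \<le> blinfun_apply (b - (y - w)) (a - z)" if "b \<in> T a" for a b
      using gap[OF that] fenchel_young[of w z] by linarith
  qed
  \<comment> \<open>The pair \<open>(z, y - w)\<close> now lies in the graph, and at this pair the
    right side of \<open>gap\<close> is 0.\<close>
  moreover from gap[OF this] have "w = j z" by (intro eq_j_if_fenchel) simp
  ultimately show ?thesis by blast
qed

end

section \<open>Convergence of resolvents\<close>

text \<open>A single functional norming x replaces weak convergence: on the normalised points it
  tends to 1, so their sums with the normalised x have norm near 2. One such pairing is what the
  resolvent estimates provide.\<close>

lemma uniformly_convex_tendsto:
  fixes u :: "'i \<Rightarrow> 'b::real_normed_vector"
  assumes uc: "uniformly_convex TYPE('b)"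
    and norm: "((\<lambda>i. norm (u i)) \<longlongrightarrow> norm x) F"
    and l: "norm l \<le> 1" "((\<lambda>i. blinfun_apply l (u i)) \<longlongrightarrow> norm x) F" "blinfun_apply l x = norm x"
  shows "(u \<longlongrightarrow> x) F"
proof (cases "x = 0")
  case True
  then show ?thesis using norm by (simp add: tendsto_norm_zero_iff)
next
  case False
  \<comment> \<open>If \<open>u i = 0\<close> then \<open>v i = 0\<close>, so the points lie in the
    unit ball, though not always on the sphere.\<close>
  define v where "v i = u i /\<^sub>R norm (u i)" for i
  define x' where "x' = x /\<^sub>R norm x"
  have v: "u i = norm (u i) *\<^sub>R v i" "norm (v i) \<le> 1" for i
    by (cases "u i = 0"; simp add: v_def)+
  have x': "x = norm x *\<^sub>R x'" "norm x' = 1" "blinfun_apply l x' = 1"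
    using False l(3) by (auto simp: x'_def blinfun.scaleR_right)
  have "((\<lambda>i. blinfun_apply l (u i) / norm (u i)) \<longlongrightarrow> norm x / norm x) F"
    using False by (intro tendsto_divide norm l) auto
  then have lim: "((\<lambda>i. blinfun_apply l (v i)) \<longlongrightarrow> 1) F"
    using False by (simp add: v_def blinfun.scaleR_right divide_inverse mult.commute)
  have "(v \<longlongrightarrow> x') F"
  proof (rule tendstoI)
    fix \<epsilon> :: real assume "\<epsilon> > 0"
    obtain \<delta> where \<delta>: "\<delta> > 0"
      "\<And>x y :: 'b. norm x \<le> 1 \<Longrightarrow> norm y \<le> 1 \<Longrightarrow> norm (x + y) > 2 - \<delta> \<Longrightarrow> norm (x - y) < \<epsilon>"
      using uniformly_convex_unit_ball[OF uc \<open>\<epsilon> > 0\<close>] by blast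
    have "\<forall>\<^sub>F i in F. blinfun_apply l (v i) > 1 - \<delta>"
      using order_tendstoD(1)[OF lim, of "1 - \<delta>"] \<delta>(1) by simp
    then show "\<forall>\<^sub>F i in F. dist (v i) x' < \<epsilon>"
    proof eventually_elim
      case (elim i)
      have "2 - \<delta> < blinfun_apply l (v i + x')" using elim x' by (simp add: blinfun.add_right)
      also have "\<dots> \<le> norm l * norm (v i + x')" by (rule blinfun_apply_le)
      also have "\<dots> \<le> 1 * norm (v i + x')" by (intro mult_right_mono l) auto
      finally show ?case using \<delta>(2)[of "v i" x'] v x' by (simp add: dist_norm)
    qed
  qed
  then have "((\<lambda>i. norm (u i) *\<^sub>R v i) \<longlongrightarrow> norm x *\<^sub>R x') F" by (intro tendsto_scaleR norm)
  then show ?thesis by (simp flip: v(1) x'(1))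
qed

text \<open>Smulian's argument: testing the subgradient inequalities at \<open>x + d *\<^sub>R h\<close> with a fixed small
  \<open>d\<close> bounds \<open>norm (w i - y)\<close>.\<close>

lemma subgradients_tendsto_derivative:
  fixes f :: "'a::real_normed_vector \<Rightarrow> real"
  assumes deriv: "(f has_derivative blinfun_apply y) (at x)"
    and u: "(u \<longlongrightarrow> x) F"
    and sub: "\<And>i v. f (u i) + blinfun_apply (w i) (v - u i) \<le> f v"
    and bound: "\<forall>\<^sub>F i in F. norm (w i) \<le> K"
  shows "(w \<longlongrightarrow> y) F"
proof (rule tendstoI)
  fix \<epsilon> :: real assume "\<epsilon> > 0"
  define e where "e = \<epsilon> / 3"
  have e: "e > 0" using \<open>\<epsilon> > 0\<close> by (simp add: e_def)
  then obtain \<delta> where \<delta>: "\<delta> > 0" "\<And>v. norm (v - x) < \<delta> \<Longrightarrow>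
      \<bar>f v - f x - blinfun_apply y (v - x)\<bar> \<le> e * norm (v - x)"
    using deriv unfolding has_derivative_at_alt real_norm_def by blast
  define d where "d = \<delta> / 2"
  have d: "d > 0" "d < \<delta>" using \<delta>(1) by (auto simp: d_def)
  have "((\<lambda>i. f x - f (u i)) \<longlongrightarrow> f x - f x) F"
    using isCont_tendsto_compose[OF has_derivative_continuous[OF deriv] u] by (intro tendsto_intros)
  moreover have "((\<lambda>i. K * norm (u i - x)) \<longlongrightarrow> K * norm (x - x)) F"
    by (intro tendsto_intros u)
  ultimately have "((\<lambda>i. f x - f (u i) + K * norm (u i - x)) \<longlongrightarrow> 0) F"
    using tendsto_add by fastforce
  \<comment> \<open>With d fixed beforehand, this error and the differentiability error are each at
    most \<open>e * d\<close>, and dividing by d leaves \<open>2 * e\<close>.\<close>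
  then have "\<forall>\<^sub>F i in F. f x - f (u i) + K * norm (u i - x) < e * d"
    using e d by (intro order_tendstoD(2)) auto
  then show "\<forall>\<^sub>F i in F. dist (w i) y < \<epsilon>"
    using bound
  proof eventually_elim
    case (elim i)
    have "norm (w i - y) \<le> 2 * e"
    proof (rule dual_norm_le)
      fix h :: 'a assume h: "norm h \<le> 1"
      have dh: "norm (d *\<^sub>R h) \<le> d" using h d by (simp add: mult_left_le)
      have "\<bar>f (x + d *\<^sub>R h) - f x - blinfun_apply y (d *\<^sub>R h)\<bar> \<le> e * norm (d *\<^sub>R h)"
        using \<delta>(2)[of "x + d *\<^sub>R h"] le_less_trans[OF dh d(2)] by simp
      then have "f (x + d *\<^sub>R h) - f x - blinfun_apply y (d *\<^sub>R h) \<le> e * norm (d *\<^sub>R h)"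
        by linarith
      also have "\<dots> \<le> e * d" using dh e by (intro mult_left_mono) auto
      finally have 1: "f (x + d *\<^sub>R h) \<le> f x + d * blinfun_apply y h + e * d"
        by (simp add: blinfun.scaleR_right)
      have "blinfun_apply (w i) (u i - x) \<le> norm (w i) * norm (u i - x)" by (rule blinfun_apply_le)
      also have "\<dots> \<le> K * norm (u i - x)" using elim(2) by (intro mult_right_mono) auto
      finally have 2: "blinfun_apply (w i) (u i - x) \<le> K * norm (u i - x)" .
      have "x + d *\<^sub>R h - u i = d *\<^sub>R h - (u i - x)" by simp
      then have "f (u i) + (d * blinfun_apply (w i) h - blinfun_apply (w i) (u i - x)) \<le> f (x + d *\<^sub>R h)"
        using sub[of i "x + d *\<^sub>R h"] by (simp only: blinfun.diff_right blinfun.scaleR_right real_scaleR_def)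
      with 1 2 elim(1) have "d * (blinfun_apply (w i) h - blinfun_apply y h) \<le> d * (2 * e)"
        unfolding right_diff_distrib by (simp add: mult.commute)
      then show "blinfun_apply (w i - y) h \<le> 2 * e"
        using d by (simp add: blinfun.diff_left)
    qed
    then show ?case using e by (simp add: dist_norm e_def)
  qed
qed

lemma (in gauge_potential) phi_gap_tendsto:
  assumes lim: "((\<lambda>i. (\<phi> (u i) - \<phi> r) * (u i - r)) \<longlongrightarrow> 0) F"
    and nonneg: "\<And>i. u i \<ge> 0" "r \<ge> 0"
  shows "(u \<longlongrightarrow> r) F"
proof (rule tendstoI)
  fix e :: real assume e: "e > 0"
  \<comment> \<open>By monotonicity the product is at least c at distance e or more from r. For
    \<open>e > r\<close> no nonnegative value lies below \<open>r - e\<close>, and the 1 is a mere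
    positive default.\<close>
  define c where "c = min ((\<phi> (r + e) - \<phi> r) * e) (if e \<le> r then (\<phi> r - \<phi> (r - e)) * e else 1)"
  have "c > 0" using e nonneg phi_less[of r "r + e"] phi_less[of "r - e" r] by (auto simp: c_def)
  then have "\<forall>\<^sub>F i in F. (\<phi> (u i) - \<phi> r) * (u i - r) < c"
    using lim by (intro order_tendstoD(2)) auto
  then show "\<forall>\<^sub>F i in F. dist (u i) r < e"
  proof eventually_elim
    case (elim i)
    show ?case
    proof (rule ccontr)
      assume "\<not> ?case"
      then consider "u i \<ge> r + e" | "u i \<le> r - e"
        unfolding dist_real_def by linarith
      then show False
      proof cases
        case 1
        have "(\<phi> (r + e) - \<phi> r) * e \<le> (\<phi> (u i) - \<phi> r) * (u i - r)"
          using 1 e nonneg phi_mono[of "r + e" "u i"] phi_mono[of r "r + e"] by (intro mult_mono) auto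
        then show False using elim by (auto simp: c_def)
      next
        case 2
        have "(\<phi> r - \<phi> (r - e)) * e \<le> (\<phi> r - \<phi> (u i)) * (r - u i)"
          using 2 e nonneg(1)[of i] phi_mono[of "u i" "r - e"] phi_mono[of "r - e" r]
          by (intro mult_mono) auto
        also have "\<dots> = (\<phi> (u i) - \<phi> r) * (u i - r)" by (simp add: algebra_simps)
        finally show False using elim 2 nonneg(1)[of i] by (auto simp: c_def)
      qed
    qed
  qed
qed

lemma uniformly_convex_imp_strictly_convex:
  assumes "uniformly_convex TYPE('a::real_normed_vector)"
  shows "strictly_convex TYPE('a)"
  unfolding strictly_convex_def
proof (intro allI impI)
  fix x y :: 'a assume xy: "norm x = 1" "norm y = 1" "x \<noteq> y"
  then have "norm (x - y) > 0" by simp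
  then obtain \<delta> where "\<delta> > 0" "norm ((1/2) *\<^sub>R (x + y)) \<le> 1 - \<delta>"
    using assms xy unfolding uniformly_convex_def by (meson order_refl)
  then show "norm ((1/2) *\<^sub>R (x + y)) < 1" by linarith
qed

context smooth_duality
begin

lemma j_defect:
  "\<phi> (norm z) * (norm z - norm x) \<le> norm z * \<phi> (norm z) - blinfun_apply (j z) x"
  using j_le[of z x] by (simp add: algebra_simps)

lemma j_diff: "blinfun_apply (j z - j x) (z - x) =
    (norm z * \<phi> (norm z) - blinfun_apply (j z) x) + (norm x * \<phi> (norm x) - blinfun_apply (j x) z)"
  by (simp add: blinfun.diff_left blinfun.diff_right j_self)

lemma j_monotone: "(\<phi> (norm z) - \<phi> (norm x)) * (norm z - norm x) \<le> blinfun_apply (j z - j x) (z - x)"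
  using j_defect[of z x] j_defect[of x z] unfolding j_diff by (simp add: algebra_simps)

text \<open>Strict monotonicity of \<open>\<phi>\<close> forces equal norms. Then both defects in
  \<open>j_diff\<close> are nonnegative with sum at most 0, so \<open>j z\<close> attains its
  maximum over the sphere at z and at x, hence at their midpoint, which strict convexity excludes
  for distinct points.\<close>

lemma j_strictly_monotone:
  assumes sc: "strictly_convex TYPE('a)" and le: "blinfun_apply (j z - j x) (z - x) \<le> 0"
  shows "z = x"
proof -
  have le0: "(\<phi> (norm z) - \<phi> (norm x)) * (norm z - norm x) \<le> 0"
    using j_monotone[of z x] le by linarith
  have eq: "norm z = norm x"
  proof (rule ccontr)
    assume "norm z \<noteq> norm x"
    then have "(\<phi> (norm z) - \<phi> (norm x)) * (norm z - norm x) > 0"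
      using phi_less[of "norm z" "norm x"] phi_less[of "norm x" "norm z"]
      by (cases "norm z < norm x") (auto simp: zero_less_mult_iff)
    with le0 show False by simp
  qed
  define r where "r = norm z"
  show ?thesis
  proof (cases "r = 0")
    case True
    then show ?thesis using eq by (simp add: r_def)
  next
    case False
    then have r: "r > 0" "\<phi> r > 0" using phi_less[of 0 r] by (auto simp: r_def phi_zero)
    have "blinfun_apply (j z) x \<ge> r * \<phi> r"
      using le j_defect[of x z] unfolding j_diff by (simp add: eq r_def)
    moreover have "blinfun_apply (j z) z = r * \<phi> r" by (simp add: j_self r_def)
    ultimately have "2 * (r * \<phi> r) \<le> blinfun_apply (j z) (z + x)" by (simp add: blinfun.add_right)
    also have "\<dots> \<le> \<phi> r * norm (z + x)" using j_le[of z "z + x"] by (simp add: r_def)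
    finally have "\<phi> r * (2 * r) \<le> \<phi> r * norm (z + x)" by (simp add: mult_ac)
    then have big: "2 * r \<le> norm (z + x)" using r by simp
    have unit: "norm (z /\<^sub>R r) = 1" "norm (x /\<^sub>R r) = 1" using r eq by (auto simp: r_def)
    have "(1/2) *\<^sub>R (z /\<^sub>R r + x /\<^sub>R r) = (1 / (2 * r)) *\<^sub>R (z + x)"
      by (simp add: algebra_simps inverse_eq_divide)
    then have "norm ((1/2) *\<^sub>R (z /\<^sub>R r + x /\<^sub>R r)) = norm (z + x) / (2 * r)"
      using r by simp
    also have "\<dots> \<ge> 1" using big r by simp
    finally have "\<not> norm ((1/2) *\<^sub>R (z /\<^sub>R r + x /\<^sub>R r)) < 1" by simp
    then have "z /\<^sub>R r = x /\<^sub>R r" using sc unit unfolding strictly_convex_def by blast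
    then show ?thesis using r by simp
  qed
qed

lemma resolvent_unique:
  assumes "strictly_convex TYPE('a)" and T: "monotone_operator T"
    and "y - j z \<in> T z" "y - j x \<in> T x"
  shows "z = x"
proof (rule j_strictly_monotone[OF assms(1)])
  have "0 \<le> blinfun_apply ((y - j z) - (y - j x)) (z - x)"
    using assms unfolding monotone_operator_def by blast
  then show "blinfun_apply (j z - j x) (z - x) \<le> 0"
    by (simp add: blinfun.diff_left)
qed

text \<open>Monotonicity against the point b of \<open>T 0\<close> gives
  \<open>\<phi> (norm z) \<le> norm (y - b)\<close>.\<close>

lemma resolvent_bounded:
  assumes T: "monotone_operator T" and b: "b \<in> T 0"
  shows "\<exists>R\<ge>0. \<forall>y z. norm y \<le> c \<longrightarrow> y - j z \<in> T z \<longrightarrow> norm z \<le> R"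
proof -
  obtain R where R: "R \<ge> 0" "\<phi> R \<ge> c + norm b + 1"
    using phi_unbounded[of "c + norm b + 1"] by blast
  have "norm z \<le> R" if y: "norm y \<le> c" and mem: "y - j z \<in> T z" for y z
  proof (rule ccontr)
    assume "\<not> norm z \<le> R"
    then have z: "norm z > R" "norm z > 0" using R(1) by linarith+
    have "0 \<le> blinfun_apply ((y - j z) - b) (z - 0)"
      using T b mem unfolding monotone_operator_def by blast
    then have "norm z * \<phi> (norm z) \<le> blinfun_apply (y - b) z"
      by (simp add: blinfun.diff_left j_self)
    also have "\<dots> \<le> norm (y - b) * norm z" by (rule blinfun_apply_le)
    finally have "\<phi> (norm z) \<le> norm (y - b)" using z by (simp add: mult.commute)
    also have "\<dots> \<le> c + norm b" using norm_triangle_ineq4[of y b] y by simp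
    finally show False using R phi_mono[of R "norm z"] z by simp
  qed
  then show ?thesis using R(1) by blast
qed

lemma resolvent_tendsto:
  assumes T: "monotone_operator T" and b: "b \<in> T 0"
    and y: "(y \<longlongrightarrow> y0) F" and z: "\<And>i. y i - j (z i) \<in> T (z i)" and z0: "y0 - j z0 \<in> T z0"
  shows "((\<lambda>i. norm (z i)) \<longlongrightarrow> norm z0) F"
    and "((\<lambda>i. blinfun_apply (j z0) (z i)) \<longlongrightarrow> norm z0 * \<phi> (norm z0)) F"
    and "((\<lambda>i. blinfun_apply (j (z i)) z0) \<longlongrightarrow> norm z0 * \<phi> (norm z0)) F"
proof -
  obtain R where R: "R \<ge> 0" "\<And>y z. norm y \<le> norm y0 + 1 \<Longrightarrow> y - j z \<in> T z \<Longrightarrow> norm z \<le> R"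
    using resolvent_bounded[OF T b] by blast
  have "\<forall>\<^sub>F i in F. norm (y i) < norm y0 + 1"
    by (rule order_tendstoD(2)[OF tendsto_norm[OF y]]) simp
  then have bnd: "\<forall>\<^sub>F i in F. norm (z i) \<le> R"
    by (rule eventually_mono) (use R(2) z less_imp_le in blast)
  define \<Delta> where "\<Delta> i = blinfun_apply (j (z i) - j z0) (z i - z0)" for i
  define \<Phi> where "\<Phi> i = (\<phi> (norm (z i)) - \<phi> (norm z0)) * (norm (z i) - norm z0)" for i
  have \<Phi>: "0 \<le> \<Phi> i" "\<Phi> i \<le> \<Delta> i" for i
  proof -
    show "0 \<le> \<Phi> i"
    proof (cases "norm (z i) \<le> norm z0")
      case True
      then show ?thesis
        unfolding \<Phi>_def using phi_mono[of "norm (z i)" "norm z0"] by (intro mult_nonpos_nonpos) auto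
    next
      case False
      then show ?thesis
        unfolding \<Phi>_def using phi_mono[of "norm z0" "norm (z i)"] by (intro mult_nonneg_nonneg) auto
    qed
    show "\<Phi> i \<le> \<Delta> i" unfolding \<Phi>_def \<Delta>_def by (rule j_monotone)
  qed
  have upper: "\<forall>\<^sub>F i in F. \<Delta> i \<le> norm (y i - y0) * (R + norm z0)"
    using bnd
  proof eventually_elim
    case (elim i)
    have "0 \<le> blinfun_apply ((y i - j (z i)) - (y0 - j z0)) (z i - z0)"
      using T z z0 unfolding monotone_operator_def by blast
    then have "\<Delta> i \<le> blinfun_apply (y i - y0) (z i - z0)"
      by (simp add: \<Delta>_def blinfun.diff_left)
    also have "\<dots> \<le> norm (y i - y0) * norm (z i - z0)" by (rule blinfun_apply_le)
    also have "\<dots> \<le> norm (y i - y0) * (R + norm z0)"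
      using elim norm_triangle_ineq4[of "z i" z0] by (intro mult_left_mono) auto
    finally show ?case .
  qed
  have zero: "((\<lambda>i. norm (y i - y0) * (R + norm z0)) \<longlongrightarrow> 0) F"
    by (intro tendsto_mult_left_zero tendsto_norm_zero) (use y in \<open>simp add: LIM_zero_iff\<close>)
  have \<Delta>0: "(\<Delta> \<longlongrightarrow> 0) F"
    by (rule tendsto_sandwich[OF _ upper tendsto_const zero]) (use \<Phi> in \<open>auto intro: order_trans always_eventually\<close>)
  have "(\<Phi> \<longlongrightarrow> 0) F"
    by (rule tendsto_sandwich[OF _ _ tendsto_const \<Delta>0]) (use \<Phi> in \<open>auto intro: always_eventually\<close>)
  then show norm: "((\<lambda>i. norm (z i)) \<longlongrightarrow> norm z0) F"
    unfolding \<Phi>_def by (rule phi_gap_tendsto) auto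
  have phi: "((\<lambda>i. \<phi> (norm (z i))) \<longlongrightarrow> \<phi> (norm z0)) F"
    by (rule phi_tendsto[OF norm]) auto
  \<comment> \<open>The two defects may be negative, but \<open>p'\<close> and \<open>q'\<close>
    bound them below and tend to 0 once the norms converge. As their sum tends to 0, each of them
    does.\<close>
  define p q where "p i = norm (z i) * \<phi> (norm (z i)) - blinfun_apply (j (z i)) z0"
    and "q i = norm z0 * \<phi> (norm z0) - blinfun_apply (j z0) (z i)" for i
  define p' q' where "p' i = \<phi> (norm (z i)) * (norm (z i) - norm z0)"
    and "q' i = \<phi> (norm z0) * (norm z0 - norm (z i))" for i
  have pq: "p' i \<le> p i" "q' i \<le> q i" "p i + q i = \<Delta> i" for i
    unfolding p_def q_def p'_def q'_def \<Delta>_def j_diff using j_defect by simp_all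
  have p'0: "(p' \<longlongrightarrow> 0) F"
    using tendsto_mult[OF phi tendsto_diff[OF norm tendsto_const[of "norm z0"]]] by (simp add: p'_def[abs_def])
  have q'0: "(q' \<longlongrightarrow> 0) F"
    using tendsto_mult[OF tendsto_const tendsto_diff[OF tendsto_const norm, of "norm z0"]]
    by (simp add: q'_def[abs_def])
  have p0: "(p \<longlongrightarrow> 0) F"
  proof (rule tendsto_sandwich[OF _ _ p'0])
    show "((\<lambda>i. \<Delta> i - q' i) \<longlongrightarrow> 0) F" using tendsto_diff[OF \<Delta>0 q'0] by simp
    show "\<forall>\<^sub>F i in F. p i \<le> \<Delta> i - q' i"
      by (intro always_eventually allI) (use pq in \<open>simp add: le_diff_eq flip: pq(3)\<close>)
    show "\<forall>\<^sub>F i in F. p' i \<le> p i" by (intro always_eventually allI pq(1))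
  qed
  have q0: "(q \<longlongrightarrow> 0) F"
  proof (rule tendsto_sandwich[OF _ _ q'0])
    show "((\<lambda>i. \<Delta> i - p' i) \<longlongrightarrow> 0) F" using tendsto_diff[OF \<Delta>0 p'0] by simp
    show "\<forall>\<^sub>F i in F. q i \<le> \<Delta> i - p' i"
      by (intro always_eventually allI) (use pq in \<open>simp add: le_diff_eq flip: pq(3)\<close>)
    show "\<forall>\<^sub>F i in F. q' i \<le> q i" by (intro always_eventually allI pq(2))
  qed
  show "((\<lambda>i. blinfun_apply (j z0) (z i)) \<longlongrightarrow> norm z0 * \<phi> (norm z0)) F"
    using tendsto_diff[OF tendsto_const q0, of "norm z0 * \<phi> (norm z0)"] by (simp add: q_def)
  show "((\<lambda>i. blinfun_apply (j (z i)) z0) \<longlongrightarrow> norm z0 * \<phi> (norm z0)) F"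
    using tendsto_diff[OF tendsto_mult[OF norm phi] p0] by (simp add: p_def)
qed

lemma resolvent_tendsto_norm:
  assumes uc: "uniformly_convex TYPE('a)"
    and "monotone_operator T" "b \<in> T 0" "(y \<longlongrightarrow> y0) F" "\<And>i. y i - j (z i) \<in> T (z i)" "y0 - j z0 \<in> T z0"
  shows "(z \<longlongrightarrow> z0) F"
proof (cases "z0 = 0")
  case True
  then show ?thesis using resolvent_tendsto(1)[OF assms(2-)] by (simp add: tendsto_norm_zero_iff)
next
  case False
  then have pos: "\<phi> (norm z0) > 0" using phi_less[of 0 "norm z0"] by (simp add: phi_zero)
  show ?thesis
  proof (rule uniformly_convex_tendsto[OF uc resolvent_tendsto(1)[OF assms(2-)]])
    let ?l = "j z0 /\<^sub>R \<phi> (norm z0)"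
    show "norm ?l \<le> 1" using pos by (simp add: norm_j)
    show "blinfun_apply ?l z0 = norm z0" using pos by (simp add: blinfun.scaleR_left j_self)
    have "((\<lambda>i. blinfun_apply (j z0) (z i) / \<phi> (norm z0)) \<longlongrightarrow> norm z0 * \<phi> (norm z0) / \<phi> (norm z0)) F"
      using pos by (intro tendsto_divide resolvent_tendsto(2)[OF assms(2-)] tendsto_const) auto
    moreover have "norm z0 * \<phi> (norm z0) / \<phi> (norm z0) = norm z0" using pos by simp
    moreover have "blinfun_apply ?l (z i) = blinfun_apply (j z0) (z i) / \<phi> (norm z0)" for i
      by (simp add: blinfun.scaleR_left divide_inverse mult.commute)
    ultimately show "((\<lambda>i. blinfun_apply ?l (z i)) \<longlongrightarrow> norm z0) F" by (simp only:)
  qed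
qed

text \<open>On the dual, the norming functional of \<open>j z0\<close> is evaluation at
  \<open>z0 /\<^sub>R norm z0\<close>. Convergence is asserted for the images under j, the values of
  the right resolvent.\<close>

lemma j_resolvent_tendsto:
  assumes uc: "uniformly_convex TYPE('a dual)"
    and "monotone_operator T" "b \<in> T 0" "(y \<longlongrightarrow> y0) F" "\<And>i. y i - j (z i) \<in> T (z i)" "y0 - j z0 \<in> T z0"
  shows "((\<lambda>i. j (z i)) \<longlongrightarrow> j z0) F"
proof -
  have norm: "((\<lambda>i. norm (j (z i))) \<longlongrightarrow> norm (j z0)) F"
    unfolding norm_j by (rule phi_tendsto[OF resolvent_tendsto(1)[OF assms(2-)]]) auto
  show ?thesis
  proof (cases "z0 = 0")
    case True
    then have "j z0 = 0" using norm_j[of z0] by (simp add: phi_zero)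
    then show ?thesis using norm by (simp add: tendsto_norm_zero_iff)
  next
    case False
    show ?thesis
    proof (rule uniformly_convex_tendsto[OF uc norm])
      let ?l = "bidual_embed (z0 /\<^sub>R norm z0)"
      show "norm ?l \<le> 1"
      proof (rule norm_blinfun_bound)
        fix f :: "'a dual"
        have "norm (blinfun_apply f (z0 /\<^sub>R norm z0)) \<le> norm f * norm (z0 /\<^sub>R norm z0)"
          by (rule norm_blinfun)
        also have "norm (z0 /\<^sub>R norm z0) = 1" using False by simp
        finally show "norm (blinfun_apply ?l f) \<le> 1 * norm f"
          unfolding blinfun_apply_bidual_embed by simp
      qed simp
      show "blinfun_apply ?l (j z0) = norm (j z0)"
        using False by (simp add: blinfun.scaleR_right j_self norm_j)
      have "((\<lambda>i. blinfun_apply (j (z i)) z0 / norm z0) \<longlongrightarrow> norm z0 * \<phi> (norm z0) / norm z0) F"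
        using False by (intro tendsto_divide resolvent_tendsto(3)[OF assms(2-)] tendsto_const) auto
      moreover have "norm z0 * \<phi> (norm z0) / norm z0 = norm (j z0)" using False by (simp add: norm_j)
      moreover have "blinfun_apply ?l (j (z i)) = blinfun_apply (j (z i)) z0 / norm z0" for i
        by (simp add: blinfun.scaleR_right divide_inverse mult.commute)
      ultimately show "((\<lambda>i. blinfun_apply ?l (j (z i))) \<longlongrightarrow> norm (j z0)) F" by (simp only:)
    qed
  qed
qed

text \<open>The left resolvent at x solves the inclusion with datum \<open>j x\<close>, so its
  continuity requires that of j. Off 0 this is Smulian's argument for the potential; at 0 the
  formula for \<open>norm (j z)\<close> suffices.\<close>

lemma j_tendsto:
  assumes fs: "frechet_smooth TYPE('a)" and deriv: "\<And>z. gateaux_derivs \<Psi> z = {j z}"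
    and u: "(u \<longlongrightarrow> x) F"
  shows "((\<lambda>i. j (u i)) \<longlongrightarrow> j x) F"
proof -
  have norm: "((\<lambda>i. norm (j (u i))) \<longlongrightarrow> norm (j x)) F"
    unfolding norm_j by (rule phi_tendsto[OF tendsto_norm[OF u]]) auto
  show ?thesis
  proof (cases "x = 0")
    case True
    then have "j x = 0" using norm_j[of x] by (simp add: phi_zero)
    then show ?thesis using norm by (simp add: tendsto_norm_zero_iff)
  next
    case False
    then obtain N where N: "(norm has_derivative N) (at x)"
      using fs by (auto simp: frechet_smooth_def differentiable_def)
    have "(G has_derivative (\<lambda>h. \<phi> (norm x) * h)) (at (norm x))"
      using G_deriv[of "norm x"] False by (simp add: has_field_derivative_def)
    from has_derivative_compose[OF N this] obtain N' where N': "(\<Psi> has_derivative N') (at x)"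
      unfolding potential_G[abs_def] by blast
    have "Blinfun N' = j x" using has_derivative_imp_gateaux_derivs[OF N'] by (simp add: deriv)
    then have "N' = blinfun_apply (j x)"
      using bounded_linear_Blinfun_apply[OF has_derivative_bounded_linear[OF N']] by metis
    with N' have deriv_j: "(\<Psi> has_derivative blinfun_apply (j x)) (at x)" by simp
    have bound: "\<forall>\<^sub>F i in F. norm (j (u i)) \<le> norm (j x) + 1"
      using order_tendstoD(2)[OF norm, of "norm (j x) + 1"] by (auto elim: eventually_mono)
    show ?thesis
    proof (rule subgradients_tendsto_derivative[OF deriv_j u _ bound])
      show "\<Psi> (u i) + blinfun_apply (j (u i)) (v - u i) \<le> \<Psi> v" for i v
        by (rule duality_map_subgradient) (simp add: duality_map_eq)
    qed
  qed
qed

section \<open>The conjugate potential\<close>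

text \<open>Otherwise some finer filter keeps the values of h away from
  \<open>blinfun_apply h x\<close>. The points stay bounded and cluster weakly at some
  \<open>x'\<close>; the subgradient inequalities pass to the limit and give
  \<open>j x' = j x\<close>, and injectivity of j yields the contradiction
  \<open>x' = x\<close>.\<close>

lemma j_inverse_weakly_continuous:
  fixes h :: "'a dual"
  assumes refl: "surj (bidual_embed :: 'a \<Rightarrow> _)" and sc: "strictly_convex TYPE('a)"
    and y: "((\<lambda>i. j (z i)) \<longlongrightarrow> j x) F"
  shows "((\<lambda>i. blinfun_apply h (z i)) \<longlongrightarrow> blinfun_apply h x) F"
proof (rule ccontr)
  assume "\<not> ?thesis"
  then obtain e where e: "e > 0" "\<not> (\<forall>\<^sub>F i in F. dist (blinfun_apply h (z i)) (blinfun_apply h x) < e)"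
    unfolding tendsto_iff by blast
  define E where "E = inf F (principal {i. dist (blinfun_apply h (z i)) (blinfun_apply h x) \<ge> e})"
  have "E \<noteq> bot" "E \<le> F"
    using e(2) by (auto simp: E_def trivial_limit_def eventually_inf_principal not_le)
  obtain R where R: "R \<ge> 0" "\<phi> R \<ge> norm (j x) + 1"
    using phi_unbounded[of "norm (j x) + 1"] by blast
  have "\<forall>\<^sub>F i in F. norm (j (z i)) < norm (j x) + 1"
    by (rule order_tendstoD(2)[OF tendsto_norm[OF y]]) simp
  then have "\<forall>\<^sub>F i in F. norm (z i) \<le> R"
  proof (rule eventually_mono)
    fix i assume "norm (j (z i)) < norm (j x) + 1"
    then show "norm (z i) \<le> R" using R phi_mono[of R "norm (z i)"] by (force simp: norm_j)
  qed
  then have bnd: "\<forall>\<^sub>F i in E. norm (z i) \<le> R" by (rule filter_leD[OF \<open>E \<le> F\<close>])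
  obtain U x' where U: "U \<le> E" "U \<noteq> bot"
    "\<And>y :: 'a dual. ((\<lambda>i. blinfun_apply y (z i)) \<longlongrightarrow> blinfun_apply y x') U"
    using reflexive_weak_cluster[OF refl \<open>E \<noteq> bot\<close> bnd] by blast
  have yU: "((\<lambda>i. j (z i)) \<longlongrightarrow> j x) U"
    using y \<open>E \<le> F\<close> U(1) by (meson order_trans tendsto_mono)
  have bndU: "\<forall>\<^sub>F i in U. norm (z i) \<le> R" by (rule filter_leD[OF U(1) bnd])
  have pair: "((\<lambda>i. blinfun_apply (j (z i)) (z i)) \<longlongrightarrow> blinfun_apply (j x) x') U"
  proof -
    have "((\<lambda>i. norm (j (z i) - j x) * R) \<longlongrightarrow> 0) U"
      by (intro tendsto_mult_left_zero tendsto_norm_zero) (use yU in \<open>simp add: LIM_zero_iff\<close>)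
    moreover have "\<forall>\<^sub>F i in U. norm (blinfun_apply (j (z i) - j x) (z i)) \<le> norm (j (z i) - j x) * R"
      using bndU
    proof eventually_elim
      case (elim i)
      then show ?case
        using norm_blinfun[of "j (z i) - j x" "z i"] mult_left_mono[OF elim, of "norm (j (z i) - j x)"]
        by simp
    qed
    ultimately have "((\<lambda>i. blinfun_apply (j (z i) - j x) (z i)) \<longlongrightarrow> 0) U"
      by (rule Lim_null_comparison[rotated])
    from tendsto_add[OF this U(3)[of "j x"]] show ?thesis by (simp add: blinfun.diff_left)
  qed
  have "j x \<in> duality_map \<phi> x'"
    unfolding duality_map_iff_subgradient
  proof
    fix v :: 'a
    \<comment> \<open>The affine minorant of slope \<open>j x'\<close>, exact at \<open>x'\<close>,
      replaces the potential at \<open>z i\<close>, so that every term converges weakly.\<close>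
    have "blinfun_apply (j x') (z i) \<le> \<Psi>c (j x') + \<Psi> v - blinfun_apply (j (z i)) v + blinfun_apply (j (z i)) (z i)" for i
      using fenchel_young[of "j x'" "z i"] duality_map_subgradient[of "j (z i)" "z i" v]
      by (simp add: duality_map_eq blinfun.diff_right)
    moreover have "((\<lambda>i. \<Psi>c (j x') + \<Psi> v - blinfun_apply (j (z i)) v + blinfun_apply (j (z i)) (z i))
        \<longlongrightarrow> \<Psi>c (j x') + \<Psi> v - blinfun_apply (j x) v + blinfun_apply (j x) x') U"
      by (intro tendsto_add tendsto_diff tendsto_const pair blinfun.tendsto[OF yU tendsto_const])
    ultimately have "blinfun_apply (j x') x' \<le> \<Psi>c (j x') + \<Psi> v - blinfun_apply (j x) v + blinfun_apply (j x) x'"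
      by (intro tendsto_le[OF U(2) _ U(3)] always_eventually allI)
    then show "\<Psi> x' + blinfun_apply (j x) (v - x') \<le> \<Psi> v"
      using j_fenchel[of x'] by (simp add: blinfun.diff_right)
  qed
  then have "j x = j x'" by (simp add: duality_map_eq)
  then have "x = x'" by (intro j_strictly_monotone[OF sc]) simp
  moreover have "\<forall>\<^sub>F i in U. dist (blinfun_apply h (z i)) (blinfun_apply h x) \<ge> e"
    by (rule filter_leD[OF U(1)]) (simp add: E_def eventually_inf_principal)
  moreover have "\<forall>\<^sub>F i in U. dist (blinfun_apply h (z i)) (blinfun_apply h x') < e"
    by (rule tendstoD[OF U(3) e(1)])
  ultimately have "\<forall>\<^sub>F i in U. False" by (auto elim: eventually_elim2)
  then show False using U(2) by simp
qed

text \<open>Fenchel-Young at x and at the preimage \<open>z t\<close> of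
  \<open>y + t *\<^sub>R h\<close> encloses the difference quotient between the values of h at x and
  at \<open>z t\<close>. The result translates the definition of the right resolvent into j after
  the inverse of T + j.\<close>

lemma gateaux_derivs_predual_conjugate:
  assumes refl: "surj (bidual_embed :: 'a \<Rightarrow> _)" and sc: "strictly_convex TYPE('a)"
  shows "gateaux_derivs_predual \<Psi>c y = {x. y = j x}"
proof (intro equalityI subsetI)
  fix x assume "x \<in> gateaux_derivs_predual \<Psi>c y"
  then have "bidual_embed x \<in> gateaux_derivs \<Psi>c y" by (simp add: gateaux_derivs_predual_def)
  from gateaux_deriv_subgradient[OF conjugate_convex this, of "j x"]
  have "\<Psi> x + \<Psi>c y \<le> blinfun_apply y x"
    using j_fenchel[of x] by (simp add: blinfun.diff_left)
  then show "x \<in> {x. y = j x}" using eq_j_if_fenchel by blast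
next
  fix x assume "x \<in> {x. y = j x}"
  then have y: "y = j x" by simp
  have "((\<lambda>t. (\<Psi>c (y + t *\<^sub>R h) - \<Psi>c y) / t) \<longlongrightarrow> blinfun_apply h x) (at 0)" for h
  proof -
    have "\<forall>t. \<exists>z. j z = y + t *\<^sub>R h" using j_surj[OF refl] by blast
    then obtain z where z: "\<And>t. j (z t) = y + t *\<^sub>R h" by (meson choice)
    have "((\<lambda>t. y + t *\<^sub>R h) \<longlongrightarrow> j x) (at 0)" using y by (auto intro!: tendsto_eq_intros)
    then have lim: "((\<lambda>t. blinfun_apply h (z t) - blinfun_apply h x) \<longlongrightarrow> 0) (at 0)"
      using j_inverse_weakly_continuous[OF refl sc, of z x "at 0" h] by (simp add: z LIM_zero_iff)
    have bound: "norm ((\<Psi>c (y + t *\<^sub>R h) - \<Psi>c y) / t - blinfun_apply h x) \<le>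
        norm (blinfun_apply h (z t) - blinfun_apply h x)" if "t \<noteq> 0" for t
    proof -
      define q where "q = (\<Psi>c (y + t *\<^sub>R h) - \<Psi>c y) / t"
      have q: "\<Psi>c (y + t *\<^sub>R h) - \<Psi>c y = t * q" using that by (simp add: q_def)
      have lower: "t * blinfun_apply h x \<le> t * q" unfolding q[symmetric]
        using j_fenchel[of x] fenchel_young[of "y + t *\<^sub>R h" x] y
        by (simp add: blinfun.add_left blinfun.scaleR_left)
      have upper: "t * q \<le> t * blinfun_apply h (z t)" unfolding q[symmetric]
        using j_fenchel[of "z t"] fenchel_young[of y "z t"] z[of t]
        by (simp add: blinfun.add_left blinfun.scaleR_left)
      have "\<bar>q - blinfun_apply h x\<bar> \<le> \<bar>blinfun_apply h (z t) - blinfun_apply h x\<bar>"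
        using lower upper that unfolding mult_le_cancel_left by linarith
      then show ?thesis by (simp add: q_def)
    qed
    have "((\<lambda>t. (\<Psi>c (y + t *\<^sub>R h) - \<Psi>c y) / t - blinfun_apply h x) \<longlongrightarrow> 0) (at 0)"
      by (rule Lim_null_comparison[OF _ tendsto_norm_zero[OF lim]])
        (use bound in \<open>auto simp: eventually_at intro!: exI[of _ 1]\<close>)
    then show ?thesis by (simp add: LIM_zero_iff)
  qed
  then show "x \<in> gateaux_derivs_predual \<Psi>c y"
    by (simp add: gateaux_derivs_predual_def gateaux_derivs_def)
qed

end

section \<open>The resolvents\<close>

lemma mem_plus_singleton: "y \<in> A + {v} \<longleftrightarrow> y - v \<in> (A :: 'a::ab_group_add set)"
proof
  assume "y - v \<in> A"
  then show "y \<in> A + {v}" by (metis diff_add_cancel insertI1 set_plus_intro)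
qed (auto simp: set_plus_def)

lemma mem_singleton_plus: "y \<in> {v} + A \<longleftrightarrow> y - v \<in> (A :: 'a::ab_group_add set)"
  by (simp only: add.commute[of "{v}"] mem_plus_singleton)

context smooth_duality
begin

lemma left_resolvent_eq:
  assumes deriv: "\<And>z. gateaux_derivs \<Psi> z = {j z}"
  shows "left_resolvent \<Psi> T = op_comp (op_inverse (op_plus T (duality_map \<phi>))) (duality_map \<phi>)"
    and "left_resolvent \<Psi> T x = {z. j x - j z \<in> T z}"
proof -
  have "op_plus (gateaux_derivs \<Psi>) T = op_plus T (duality_map \<phi>)" "gateaux_derivs \<Psi> = duality_map \<phi>"
    by (simp_all add: fun_eq_iff op_plus_def deriv duality_map_eq add.commute[of "{_}"])
  then show "left_resolvent \<Psi> T = op_comp (op_inverse (op_plus T (duality_map \<phi>))) (duality_map \<phi>)"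
    by (simp only: left_resolvent_def)
  then show "left_resolvent \<Psi> T x = {z. j x - j z \<in> T z}"
    by (simp add: op_comp_def op_inverse_def op_plus_def duality_map_eq mem_plus_singleton)
qed

lemma right_resolvent_eq:
  assumes predual: "\<And>y. gateaux_derivs_predual \<Psi>c y = {x. y = j x}"
  shows "right_resolvent \<Psi> T = op_comp (duality_map \<phi>) (op_inverse (op_plus T (duality_map \<phi>)))"
    and "right_resolvent \<Psi> T y = j ` {z. y - j z \<in> T z}"
proof -
  have mem: "v \<in> right_resolvent \<Psi> T y \<longleftrightarrow> (\<exists>x. v = j x \<and> y - j x \<in> T x)" for v y
    unfolding right_resolvent_def op_inverse_def op_plus_def op_comp_def predual
      mem_Collect_eq mem_singleton_plus UN_iff by blast
  then show "right_resolvent \<Psi> T y = j ` {z. y - j z \<in> T z}" by blast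
  show "right_resolvent \<Psi> T = op_comp (duality_map \<phi>) (op_inverse (op_plus T (duality_map \<phi>)))"
  proof (intro ext set_eqI)
    fix y v
    show "v \<in> right_resolvent \<Psi> T y \<longleftrightarrow>
        v \<in> op_comp (duality_map \<phi>) (op_inverse (op_plus T (duality_map \<phi>))) y"
      unfolding mem op_comp_def op_inverse_def op_plus_def duality_map_eq UN_iff mem_Collect_eq
        mem_plus_singleton by blast
  qed
qed

end

lemma (in gauge_potential) left_resolvent_continuous:
  fixes T :: "'a::banach \<Rightarrow> 'a dual set"
  assumes T: "maximally_monotone T" and T0: "T 0 \<noteq> {}"
    and fs: "frechet_smooth TYPE('a)" and uc: "uniformly_convex TYPE('a)"
  shows "left_resolvent (potential \<phi>) T =
      op_comp (op_inverse (op_plus T (duality_map \<phi>))) (duality_map \<phi>)"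
    and "\<exists>R. (\<forall>x. left_resolvent (potential \<phi>) T x = {R x}) \<and> range R = op_dom T \<and>
      continuous_on UNIV R"
proof -
  obtain j :: "'a \<Rightarrow> 'a dual" where j: "\<And>z. duality_map \<phi> z = {j z}"
    "\<And>z. gateaux_derivs (potential \<phi>) z = {j z}"
    using smooth_duality_map[OF frechet_smooth_imp_gateaux_smooth[OF fs]] by blast
  interpret smooth_duality \<phi> j by unfold_locales (rule j(1))
  have mono: "monotone_operator T" using T by (simp add: maximally_monotone_def)
  have refl: "surj (bidual_embed :: 'a \<Rightarrow> _)" by (rule milman_pettis[OF uc])
  have sc: "strictly_convex TYPE('a)" by (rule uniformly_convex_imp_strictly_convex[OF uc])
  show "left_resolvent (potential \<phi>) T =
      op_comp (op_inverse (op_plus T (duality_map \<phi>))) (duality_map \<phi>)"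
    by (rule left_resolvent_eq(1)[OF j(2)])
  have "\<forall>x. \<exists>z. j x - j z \<in> T z" using resolvent_exists[OF refl T T0] by blast
  then obtain R where R: "\<And>x. j x - j (R x) \<in> T (R x)" by (meson choice)
  have "left_resolvent (potential \<phi>) T x = {R x}" for x
    unfolding left_resolvent_eq(2)[OF j(2)] using R resolvent_unique[OF sc mono] by blast
  moreover have "range R = op_dom T"
  proof (intro equalityI subsetI)
    fix z assume "z \<in> range R"
    then show "z \<in> op_dom T" using R by (auto simp: op_dom_def)
  next
    fix z assume "z \<in> op_dom T"
    then obtain b where b: "b \<in> T z" by (auto simp: op_dom_def)
    \<comment> \<open>Surjectivity of j provides the datum for which z is the solution; on the dual
      side \<open>b + j x\<close> itself is the datum.\<close>
    obtain x where x: "j x = b + j z" using j_surj[OF refl] by blast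
    then have "j x - j z \<in> T z" using b by simp
    then have "R x = z" using R resolvent_unique[OF sc mono] by blast
    then show "z \<in> range R" by blast
  qed
  moreover have "continuous_on UNIV R"
  proof -
    obtain b where b: "b \<in> T 0" using T0 by blast
    have "(R \<longlongrightarrow> R x) (at x)" for x
      by (rule resolvent_tendsto_norm[OF uc mono b j_tendsto[OF fs j(2) tendsto_ident_at] R R])
    then show ?thesis by (simp add: continuous_on_def)
  qed
  ultimately show "\<exists>R. (\<forall>x. left_resolvent (potential \<phi>) T x = {R x}) \<and> range R = op_dom T \<and>
      continuous_on UNIV R" by blast
qed

lemma (in gauge_potential) right_resolvent_continuous:
  fixes T :: "'a::banach \<Rightarrow> 'a dual set"
  assumes T: "maximally_monotone T" and T0: "T 0 \<noteq> {}"
    and sc: "strictly_convex TYPE('a)" and us: "uniformly_frechet_smooth TYPE('a)"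
  shows "right_resolvent (potential \<phi>) T =
      op_comp (duality_map \<phi>) (op_inverse (op_plus T (duality_map \<phi>)))"
    and "\<exists>R. (\<forall>y. right_resolvent (potential \<phi>) T y = {R y}) \<and>
      range R = (\<Union>x\<in>op_dom T. duality_map \<phi> x) \<and> continuous_on UNIV R"
proof -
  obtain j :: "'a \<Rightarrow> 'a dual" where j: "\<And>z. duality_map \<phi> z = {j z}"
    "\<And>z. gateaux_derivs (potential \<phi>) z = {j z}"
    using smooth_duality_map[OF uniformly_frechet_smooth_imp_gateaux_smooth[OF us]] by blast
  interpret smooth_duality \<phi> j by unfold_locales (rule j(1))
  have mono: "monotone_operator T" using T by (simp add: maximally_monotone_def)
  have uc: "uniformly_convex TYPE('a dual)"
    by (rule uniformly_frechet_smooth_imp_uniformly_convex_dual[OF us])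
  have refl: "surj (bidual_embed :: 'a \<Rightarrow> _)"
    by (rule reflexive_if_uniformly_convex_dual[OF uc norm_le_bidual_embed])
  note eq = right_resolvent_eq[OF gateaux_derivs_predual_conjugate[OF refl sc]]
  show "right_resolvent (potential \<phi>) T =
      op_comp (duality_map \<phi>) (op_inverse (op_plus T (duality_map \<phi>)))"
    by (rule eq(1))
  have "\<forall>y. \<exists>z. y - j z \<in> T z" using resolvent_exists[OF refl T T0] by blast
  then obtain z where z: "\<And>y. y - j (z y) \<in> T (z y)" by (meson choice)
  have z_unique: "z y = x" if "y - j x \<in> T x" for x y
    using resolvent_unique[OF sc mono z that] .
  have "right_resolvent (potential \<phi>) T y = {j (z y)}" for y
    unfolding eq(2) using z z_unique by blast
  moreover have "range (\<lambda>y. j (z y)) = (\<Union>x\<in>op_dom T. duality_map \<phi> x)"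
  proof (intro equalityI subsetI)
    fix v assume "v \<in> range (\<lambda>y. j (z y))"
    then show "v \<in> (\<Union>x\<in>op_dom T. duality_map \<phi> x)" using z by (auto simp: op_dom_def j(1))
  next
    fix v assume "v \<in> (\<Union>x\<in>op_dom T. duality_map \<phi> x)"
    then obtain x b where x: "v = j x" "b \<in> T x" by (auto simp: op_dom_def j(1))
    then have "z (b + j x) = x" by (intro z_unique) simp
    then show "v \<in> range (\<lambda>y. j (z y))" using x(1) by (intro image_eqI[of _ _ "b + j x"]) auto
  qed
  moreover have "continuous_on UNIV (\<lambda>y. j (z y))"
  proof -
    obtain b where b: "b \<in> T 0" using T0 by blast
    have "((\<lambda>y. j (z y)) \<longlongrightarrow> j (z y0)) (at y0)" for y0
      by (rule j_resolvent_tendsto[OF uc mono b tendsto_ident_at z z])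
    then show ?thesis by (simp add: continuous_on_def)
  qed
  ultimately show "\<exists>R. (\<forall>y. right_resolvent (potential \<phi>) T y = {R y}) \<and>
      range R = (\<Union>x\<in>op_dom T. duality_map \<phi> x) \<and> continuous_on UNIV R"
    by (intro exI[of _ "\<lambda>y. j (z y)"]) simp
qed

theorem proposition3p31:
  fixes T :: "'a::banach \<Rightarrow> ('a \<Rightarrow>\<^sub>L real) set" and \<phi> :: "real \<Rightarrow> real"
  assumes "gauge_fun \<phi>"
    and "maximally_monotone T"
    and "T 0 \<noteq> {}"
  shows "(frechet_smooth TYPE('a) \<and> uniformly_convex TYPE('a) \<longrightarrow>
      left_resolvent (potential \<phi>) T =
        op_comp (op_inverse (op_plus T (duality_map \<phi>))) (duality_map \<phi>) \<and>
      (\<exists>R :: 'a \<Rightarrow> 'a.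
        (\<forall>x. left_resolvent (potential \<phi>) T x = {R x}) \<and>
        range R = op_dom T \<and>
        continuous_on UNIV R)) \<and>
    (strictly_convex TYPE('a) \<and> uniformly_frechet_smooth TYPE('a) \<and>
        radon_riesz_shmulyan TYPE('a) \<longrightarrow>
      right_resolvent (potential \<phi>) T =
        op_comp (duality_map \<phi>) (op_inverse (op_plus T (duality_map \<phi>))) \<and>
      (\<exists>R :: ('a \<Rightarrow>\<^sub>L real) \<Rightarrow> ('a \<Rightarrow>\<^sub>L real).
        (\<forall>y. right_resolvent (potential \<phi>) T y = {R y}) \<and>
        range R = (\<Union>x\<in>op_dom T. duality_map \<phi> x) \<and>
        continuous_on UNIV R))"
proof -
  interpret gauge_potential \<phi> by unfold_locales (rule assms(1))
  show ?thesis
    by (intro conjI impI; elim conjE)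
      (rule left_resolvent_continuous[OF assms(2,3)] right_resolvent_continuous[OF assms(2,3)]; assumption)+
qed

end
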